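(* Let $p\in(0,1)$, and let $(\mathcal{G}_x)_{x\in\mathbb{Z}^2}$ be i.i.d. with $\mathcal{G}_x=\{e_1,-e_1\}$ with probability $p$ and $\mathcal{G}_x=\{e_1\}$ with probability $1-p$. Then the random walk $(X_n)$ in the associated uniform random environment, started at the origin, satisfies $P(n^{-1}X_n\to v)=1$ with $$v=\Big(\frac{1-p}{1+p},\ 0\Big).$$
   Context: $e_1=(1,0)$ and $e_2=(0,1)$ are the unit vectors of $\mathbb{Z}^2$. Given a realization of the i.i.d. non-empty sets $(\mathcal{G}_x)_{x\in\mathbb{Z}^2}$, each a subset of $\{\pm e_1,\pm e_2\}$, the walk in the associated uniform random environment is the time-homogeneous Markov chain $(X_n)_{n\ge0}$ on $\mathbb{Z}^2$ with $X_0=0$ that moves from $x$ to $x+e$ with probability $1/|\mathcal{G}_x|$ if $e\in\mathcal{G}_x$, and with probability $0$ otherwise. The environment is sampled once and kept fixed. $P$ denotes the annealed law, i.e. the law of the walk averaged over the environment. *)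

theory Defs
  imports "HOL-Probability.Probability"
begin

section \<open>Time-homogeneous Markov chains on a discrete state space\<close>

text \<open>
  The law, on the path space \<open>nat \<Rightarrow> 'a\<close>, of the Markov chain with transition kernel \<open>K\<close> started
  at \<open>x\<close> is obtained from the Ionescu-Tulcea theorem. The kernel at time \<open>n\<close> takes as its
  argument the history restricted to the times \<open>{0..<n}\<close>.
\<close>

definition chain_kernel :: "('a \<Rightarrow> 'a pmf) \<Rightarrow> 'a \<Rightarrow> nat \<Rightarrow> (nat \<Rightarrow> 'a) \<Rightarrow> 'a measure" where
  "chain_kernel K x n h =
     (case n of 0 \<Rightarrow> measure_pmf (return_pmf x) | Suc m \<Rightarrow> measure_pmf (K (h m)))"

definition markov_law :: "('a \<Rightarrow> 'a pmf) \<Rightarrow> 'a \<Rightarrow> (nat \<Rightarrow> 'a) measure" where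
  "markov_law K x =
     projective_family.lim UNIV
       (Ionescu_Tulcea.CI (chain_kernel K x) (\<lambda>_. count_space UNIV)) (\<lambda>_. count_space UNIV)"

lemma Ionescu_Tulcea_chain_kernel:
  "Ionescu_Tulcea (chain_kernel K x) (\<lambda>_. count_space UNIV)"
proof (rule Ionescu_Tulcea.intro)
  fix i :: nat
  show "chain_kernel K x i \<in> PiM {0..<i} (\<lambda>_. count_space UNIV) \<rightarrow>\<^sub>M subprob_algebra (count_space UNIV)"
  proof (cases i)
    case 0
    then show ?thesis
      by (auto simp: chain_kernel_def[abs_def] intro!: measurable_const measure_pmf_in_subprob_algebra)
  next
    case (Suc m)
    have "(\<lambda>y. measure_pmf (K y)) \<in> count_space UNIV \<rightarrow>\<^sub>M subprob_algebra (count_space UNIV)"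
      by (simp add: measure_pmf_in_subprob_algebra)
    moreover have "(\<lambda>h. h m) \<in> PiM {0..<i} (\<lambda>_. count_space UNIV) \<rightarrow>\<^sub>M count_space UNIV"
      using Suc by (intro measurable_component_singleton) auto
    ultimately show ?thesis
      using Suc by (simp add: chain_kernel_def[abs_def] measurable_compose)
  qed
next
  fix i :: nat and h :: "nat \<Rightarrow> 'a"
  assume "h \<in> space (PiM {0..<i} (\<lambda>_. count_space UNIV))"
  show "prob_space (chain_kernel K x i h)"
    by (cases i) (simp_all add: chain_kernel_def measure_pmf.prob_space_axioms)
qed

interpretation chain: Ionescu_Tulcea "chain_kernel K x" "\<lambda>_. count_space UNIV" for K x
  by (rule Ionescu_Tulcea_chain_kernel)

lemma sets_markov_law [measurable_cong]:
  "sets (markov_law K x) = sets (PiM UNIV (\<lambda>_. count_space UNIV))"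
  unfolding markov_law_def by (rule chain.PF.sets_lim)

lemma space_markov_law [simp]: "space (markov_law K x) = UNIV"
  using sets_eq_imp_space_eq[OF sets_markov_law[of K x]] by (simp add: space_PiM)

lemma cylinder_eq_emb:
  "{w. \<forall>i\<le>n. w i = f i} =
     prod_emb UNIV (\<lambda>_. count_space UNIV) {0..<Suc n} {restrict f {0..<Suc n}}"
  by (auto simp: prod_emb_def restrict_def fun_eq_iff less_Suc_eq_le) metis+

lemma singleton_in_sets_PiM:
  "{restrict f {0..<n}} \<in> sets (PiM {0..<n} (\<lambda>_. count_space (UNIV :: 'a set)))" for n :: nat
proof -
  have "{restrict f {0..<n}} = PiE {0..<n} (\<lambda>i. {f i})"
    by (auto simp: PiE_iff extensional_def restrict_def fun_eq_iff)
  then show ?thesis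
    by (simp add: sets_PiM_I_finite)
qed

lemma emeasure_chain_C:
  "emeasure (chain.C K x 0 (Suc n) (\<lambda>_. undefined)) {restrict f {0..<Suc n}} =
     (if f 0 = x then ennreal (\<Prod>i<n. pmf (K (f i)) (f (Suc i))) else 0)"
proof (induction n)
  case 0
  have "emeasure (chain.C K x 0 (Suc 0) (\<lambda>_. undefined)) {restrict f {0..<Suc 0}} =
      emeasure (chain.eP K x 0 (\<lambda>_. undefined)) {restrict f {0..<Suc 0}}"
    using bind_return[OF chain.measurable_eP[of K x 0], of "\<lambda>_. undefined"] by (simp add: space_PiM)
  also have "\<dots> = emeasure (chain_kernel K x 0 (\<lambda>_. undefined))
      {y. (\<lambda>_. undefined)(0 := y) = restrict f {0..<Suc 0}}"
    using singleton_in_sets_PiM[of f "Suc 0"]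
    by (subst chain.emeasure_eP) (auto simp: space_PiM vimage_def)
  also have "{y. (\<lambda>_. undefined)(0 := y) = restrict f {0..<Suc 0}} = {f 0}"
    by (auto simp: fun_eq_iff)
  finally show ?case
    by (simp add: chain_kernel_def emeasure_pmf_single)
next
  case (Suc n)
  let ?C = "chain.C K x 0 (Suc n) (\<lambda>_. undefined)"
  let ?A = "\<lambda>n. {restrict f {0..<n}}"
  let ?c = "ennreal (pmf (K (f n)) (f (Suc n)))"
  have space_C: "space ?C = space (PiM {0..<Suc n} (\<lambda>_. count_space UNIV))"
    by (subst chain.space_C) (simp_all add: space_PiM)
  have sets_C: "sets ?C = sets (PiM {0..<Suc n} (\<lambda>_. count_space UNIV))"
    by (subst chain.sets_C) (simp_all add: space_PiM)
  have eP: "emeasure (chain.eP K x (Suc n) h) (?A (Suc (Suc n))) = ?c * indicator (?A (Suc n)) h"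
    if h: "h \<in> space ?C" for h
  proof -
    have ext: "h i = undefined" if "i \<ge> Suc n" for i
      using h that unfolding space_C by (auto simp: space_PiM PiE_iff extensional_def)
    have "emeasure (chain.eP K x (Suc n) h) (?A (Suc (Suc n))) =
        emeasure (chain_kernel K x (Suc n) h) {y. h(Suc n := y) = restrict f {0..<Suc (Suc n)}}"
      using h[unfolded space_C] singleton_in_sets_PiM[of f "Suc (Suc n)"]
      by (subst chain.emeasure_eP) (auto simp: vimage_def)
    also have "{y. h(Suc n := y) = restrict f {0..<Suc (Suc n)}} =
        (if h = restrict f {0..<Suc n} then {f (Suc n)} else {})"
      using ext by (auto simp: fun_eq_iff restrict_def less_Suc_eq)
    also have "emeasure (chain_kernel K x (Suc n) h) \<dots> = ?c * indicator (?A (Suc n)) h"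
      by (auto simp: chain_kernel_def emeasure_pmf_single)
    finally show ?thesis .
  qed
  have "emeasure (chain.C K x 0 (Suc (Suc n)) (\<lambda>_. undefined)) (?A (Suc (Suc n))) =
      (\<integral>\<^sup>+h. emeasure (chain.eP K x (Suc n) h) (?A (Suc (Suc n))) \<partial>?C)"
  proof -
    have "chain.eP K x (Suc n) \<in> ?C \<rightarrow>\<^sub>M subprob_algebra (PiM {0..<Suc (Suc n)} (\<lambda>_. count_space UNIV))"
      using chain.measurable_eP[of K x "Suc n"] by (simp only: measurable_cong_sets[OF sets_C refl])
    moreover have "space ?C \<noteq> {}"
      unfolding space_C by (simp add: space_PiM PiE_eq_empty_iff)
    ultimately have "emeasure (?C \<bind> chain.eP K x (Suc n)) (?A (Suc (Suc n))) =
      (\<integral>\<^sup>+h. emeasure (chain.eP K x (Suc n) h) (?A (Suc (Suc n))) \<partial>?C)"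
      by (intro emeasure_bind[OF _ _ singleton_in_sets_PiM])
    then show ?thesis
      by (subst chain.C.simps(2)) simp
  qed
  also have "\<dots> = (\<integral>\<^sup>+h. ?c * indicator (?A (Suc n)) h \<partial>?C)"
    by (intro nn_integral_cong eP)
  also have "\<dots> = ?c * emeasure ?C (?A (Suc n))"
    by (intro nn_integral_cmult_indicator) (simp only: sets_C singleton_in_sets_PiM)
  also have "\<dots> = (if f 0 = x then ennreal (\<Prod>i<Suc n. pmf (K (f i)) (f (Suc i))) else 0)"
    unfolding Suc.IH by (simp add: mult.commute prod_nonneg flip: ennreal_mult)
  finally show ?case .
qed

theorem emeasure_markov_law_cylinder:
  "emeasure (markov_law K x) {w. \<forall>i\<le>n. w i = f i} =
     (if f 0 = x then ennreal (\<Prod>i<n. pmf (K (f i)) (f (Suc i))) else 0)"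
proof -
  have "emeasure (markov_law K x) {w. \<forall>i\<le>n. w i = f i} =
      emeasure (chain.CI K x {0..<Suc n}) {restrict f {0..<Suc n}}"
    unfolding cylinder_eq_emb markov_law_def
    by (rule chain.lim) (auto intro: singleton_in_sets_PiM)
  also have "\<dots> = emeasure (chain.C K x 0 (Suc n) (\<lambda>_. undefined)) {restrict f {0..<Suc n}}"
    by (subst chain.emeasure_CI[of _ "Suc n"])
      (auto intro: singleton_in_sets_PiM simp: prod_emb_id)
  finally show ?thesis
    by (simp only: emeasure_chain_C)
qed

lemma prob_space_markov_law: "prob_space (markov_law K x)"
proof
  let ?M = "\<lambda>_ :: nat. count_space (UNIV :: 'a set)"
  have "prod_emb UNIV ?M {} (space (PiM {} ?M)) = UNIV"
    by (auto simp: prod_emb_def space_PiM)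
  then have "emeasure (markov_law K x) UNIV = emeasure (chain.CI K x {}) (space (PiM {} ?M))"
    unfolding markov_law_def
    using chain.lim[of "{}" "space (PiM {} ?M)" K x] by simp
  also have "\<dots> = 1"
    using prob_space.emeasure_space_1[OF chain.PF.prob_space_P[of "{}" K x]]
    by (simp add: chain.PF.space_P)
  finally show "emeasure (markov_law K x) (space (markov_law K x)) = 1"
    by simp
qed

lemma sets_path_space_eq_sigma_cylinders:
  "sets (PiM UNIV (\<lambda>_ :: nat. count_space (UNIV :: 'a :: countable set))) =
     sigma_sets UNIV (insert {} {{w. \<forall>i\<le>n. w i = f i} | n f. True})" (is "?L = sigma_sets _ ?G")
proof
  show "sigma_sets UNIV ?G \<subseteq> ?L"
  proof -
    have "{w. \<forall>i\<le>n. w i = f i} \<in> ?L" for n and f :: "nat \<Rightarrow> 'a"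
      unfolding cylinder_eq_emb
      by (rule measurable_prod_emb) (auto intro: singleton_in_sets_PiM)
    then have "?G \<subseteq> ?L"
      by auto
    moreover have "space (PiM UNIV (\<lambda>_ :: nat. count_space (UNIV :: 'a set))) = UNIV"
      by (simp add: space_PiM)
    ultimately show ?thesis
      using sets.sigma_sets_subset[of ?G "PiM UNIV (\<lambda>_ :: nat. count_space (UNIV :: 'a set))"] by simp
  qed
  interpret S: sigma_algebra UNIV "sigma_sets UNIV ?G"
    by (rule sigma_algebra_sigma_sets) simp
  show "?L \<subseteq> sigma_sets UNIV ?G"
  proof -
    have "?L = sigma_sets UNIV {{w. w i \<in> A} | i A. True}"
      by (simp add: sets_PiM_single PiE_UNIV_domain)
    moreover have "{{w. w i \<in> A} | i A. True} \<subseteq> sigma_sets UNIV ?G"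
    proof safe
      fix n :: nat and A :: "'a set"
      let ?F = "{f \<in> PiE {0..<Suc n} (\<lambda>_. UNIV). f n \<in> A}"
      have "countable ?F"
        by (rule countable_subset[OF _ countable_PiE[of "{0..<Suc n}" "\<lambda>_. UNIV"]]) auto
      then have "(\<Union>f\<in>?F. {w. \<forall>i\<le>n. w i = f i}) \<in> sigma_sets UNIV ?G"
        by (intro S.countable_UN'') auto
      also have "(\<Union>f\<in>?F. {w. \<forall>i\<le>n. w i = f i}) = {w. w n \<in> A}"
      proof safe
        fix w :: "nat \<Rightarrow> 'a"
        assume "w n \<in> A"
        then show "w \<in> (\<Union>f\<in>?F. {w. \<forall>i\<le>n. w i = f i})"
          by (intro UN_I[of "restrict w {0..<Suc n}"]) auto
      qed auto
      finally show "{w. w n \<in> A} \<in> sigma_sets UNIV ?G" .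
    qed
    ultimately show ?thesis
      by (metis (no_types, lifting) S.sigma_sets_subset)
  qed
qed

lemma Int_stable_cylinders:
  "Int_stable (insert {} {{w. \<forall>i\<le>n. w i = f i} | n (f :: nat \<Rightarrow> 'a). True})"
proof -
  have Int: "{w. \<forall>i\<le>m. w i = f i} \<inter> {w. \<forall>i\<le>n. w i = g i} \<in>
      insert {} {{w. \<forall>i\<le>n. w i = f i} | n f. True}" for m n and f g :: "nat \<Rightarrow> 'a"
  proof (cases "{w. \<forall>i\<le>m. w i = f i} \<inter> {w. \<forall>i\<le>n. w i = g i} = {}")
    case False
    then obtain h where "\<forall>i\<le>m. h i = f i" "\<forall>i\<le>n. h i = g i"
      by auto
    then have "{w. \<forall>i\<le>m. w i = f i} \<inter> {w. \<forall>i\<le>n. w i = g i} = {w. \<forall>i\<le>max m n. w i = h i}"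
      by (auto simp: le_max_iff_disj)
    then show ?thesis
      by blast
  qed simp
  show ?thesis
  proof (rule Int_stableI)
    fix a b :: "(nat \<Rightarrow> 'a) set"
    assume "a \<in> insert {} {{w. \<forall>i\<le>n. w i = f i} | n f. True}"
      and "b \<in> insert {} {{w. \<forall>i\<le>n. w i = f i} | n f. True}"
    then show "a \<inter> b \<in> insert {} {{w. \<forall>i\<le>n. w i = f i} | n f. True}"
      by (elim insertE CollectE exE conjE)
        (simp_all only: Int Int_empty_left Int_empty_right insertI1)
  qed
qed


section \<open>Walks in uniform random environments on the square lattice\<close>

definition e1 :: "int \<times> int" where "e1 = (1, 0)"

definition e2 :: "int \<times> int" where "e2 = (0, 1)"

definition unit_steps :: "(int \<times> int) set" where
  "unit_steps = {e1, - e1, e2, - e2}"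

type_synonym environment = "int \<times> int \<Rightarrow> (int \<times> int) set"

definition walk_step :: "environment \<Rightarrow> int \<times> int \<Rightarrow> (int \<times> int) pmf" where
  "walk_step g x = map_pmf (\<lambda>e. x + e) (pmf_of_set (g x))"

definition quenched_law :: "environment \<Rightarrow> (nat \<Rightarrow> int \<times> int) measure" where
  "quenched_law g = markov_law (walk_step g) 0"

text \<open>
  The environment is given by random variables \<open>G x\<close> on a probability space \<open>M\<close>. The Giry bind
  integrates the quenched laws against \<open>M\<close>; \<open>emeasure_annealed_law\<close> below spells this out.
\<close>

definition annealed_law ::
    "'w measure \<Rightarrow> (int \<times> int \<Rightarrow> 'w \<Rightarrow> (int \<times> int) set) \<Rightarrow> (nat \<Rightarrow> int \<times> int) measure" where
  "annealed_law M G = M \<bind> (\<lambda>\<omega>. quenched_law (\<lambda>x. G x \<omega>))"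

lemma pmf_walk_step:
  assumes "g x \<subseteq> unit_steps" "g x \<noteq> {}"
  shows "pmf (walk_step g x) (x + e) = (if e \<in> g x then 1 / card (g x) else 0)"
proof -
  have "finite (g x)"
    using assms(1) by (rule finite_subset) (simp add: unit_steps_def)
  moreover have "pmf (walk_step g x) (x + e) = pmf (pmf_of_set (g x)) e"
    unfolding walk_step_def by (rule pmf_map_inj') (auto simp: inj_def)
  ultimately show ?thesis
    using assms(2) by (simp add: indicator_def)
qed

lemma measurable_quenched_law:
  assumes "\<And>x. G x \<in> M \<rightarrow>\<^sub>M count_space (Pow unit_steps - {{}})"
  shows "(\<lambda>\<omega>. quenched_law (\<lambda>x. G x \<omega>)) \<in> M \<rightarrow>\<^sub>M prob_algebra (PiM UNIV (\<lambda>_. count_space UNIV))"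
proof (rule measurable_prob_algebra_generated[OF sets_path_space_eq_sigma_cylinders Int_stable_cylinders])
  fix A :: "(nat \<Rightarrow> int \<times> int) set"
  assume "A \<in> insert {} {{w. \<forall>i\<le>n. w i = f i} | n f. True}"
  then consider "A = {}" | n f where "A = {w. \<forall>i\<le>n. w i = f i}"
    by blast
  then show "(\<lambda>\<omega>. emeasure (quenched_law (\<lambda>x. G x \<omega>)) A) \<in> borel_measurable M"
  proof cases
    case 2
    have "(\<lambda>\<omega>. pmf (walk_step (\<lambda>x. G x \<omega>) y) z) \<in> borel_measurable M" for y z
      unfolding walk_step_def
      by (rule measurable_compose[OF assms[of y]]) simp
    then show ?thesis
      unfolding 2 quenched_law_def emeasure_markov_law_cylinder by simp
  qed simp
qed (auto simp: quenched_law_def prob_space_markov_law sets_markov_law)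

lemma emeasure_annealed_law:
  assumes "prob_space M"
    and "\<And>x. G x \<in> M \<rightarrow>\<^sub>M count_space (Pow unit_steps - {{}})"
    and "A \<in> sets (PiM UNIV (\<lambda>_. count_space UNIV))"
  shows "emeasure (annealed_law M G) A = (\<integral>\<^sup>+\<omega>. emeasure (quenched_law (\<lambda>x. G x \<omega>)) A \<partial>M)"
  unfolding annealed_law_def
  using assms measurable_quenched_law[OF assms(2)]
  by (intro emeasure_bind measurable_prob_algebraD) (auto simp: prob_space.not_empty)

end

theory Submission
  imports Defs "HOL-Real_Asymp.Real_Asymp" "HOL-Library.Discrete_Functions"
begin

text \<open>
  A site \<open>x\<close> with \<open>G x = {e1}\<close> is a barrier, so the walk never gets behind the first barrier to the
  left of the origin. Index the sites of the axis from that barrier on by \<open>y = 0, 1, ...\<close>, let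
  \<open>S y\<close> be the number of consecutive two-way sites ending at \<open>y\<close> and put
  \<open>h y = 1 + 2 * S y\<close>, the mean time needed to get from \<open>y\<close> to \<open>y + 1\<close>. With
  \<open>\<phi> y = h 0 + ... + h (y - 1)\<close>, the process \<open>\<phi> (Y n) - n\<close> is a martingale for every fixed
  environment, with increments \<open>\<plusminus>2 * S (Y n)\<close>. In the environment,
  \<open>Z N = (1 - p) * (S 0 + ... + S (N - 1)) + S N - p * N\<close> is a martingale as well.

  In both cases the second moment at time \<open>n\<close> is \<open>O(n powr (5/4))\<close> and the increments are
  \<open>O(n powr (1/8))\<close>, because \<open>S\<close> has geometric tails. Hence both martingales are \<open>o(n)\<close> almost
  surely, first along the squares and then everywhere. The second one gives
  \<open>\<phi> y / y \<longlonglongrightarrow> 1 + 2 * p / (1 - p) = (1 + p) / (1 - p)\<close>, the first one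
  \<open>\<phi> (Y n) / n \<longlonglongrightarrow> 1\<close>; the quotient is the speed.
\<close>

section \<open>A strong law from second moments\<close>

text \<open>Any \<open>n\<close> is at most \<open>2 * sqrt n\<close> steps away from the largest
  square below or equal to it, and each step changes \<open>a\<close> by
  \<open>O(n powr (1/8))\<close>. The total change \<open>O(n powr (5/8))\<close> vanishes after
  division by \<open>n\<close>.\<close>

lemma LIMSEQ_div_of_squares:
  fixes a :: "nat \<Rightarrow> real"
  assumes sq: "(\<lambda>k. a (k\<^sup>2) / real (k\<^sup>2)) \<longlonglongrightarrow> 0"
    and inc: "\<And>n. \<bar>a (Suc n) - a n\<bar> \<le> C * (1 + real n) powr (1/8)"
  shows "(\<lambda>n. a n / real n) \<longlonglongrightarrow> 0"
proof -
  have C: "0 \<le> C"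
    using inc[of 0] by simp
  have add: "\<bar>a (m + j) - a m\<bar> \<le> real j * (C * (1 + real (m + j)) powr (1/8))" for m j
  proof (induction j)
    case (Suc j)
    have mono: "C * (1 + real (m + j)) powr (1/8) \<le> C * (1 + real (m + Suc j)) powr (1/8)"
      using C by (intro mult_left_mono powr_mono2) auto
    have "\<bar>a (m + Suc j) - a m\<bar> \<le> \<bar>a (Suc (m + j)) - a (m + j)\<bar> + \<bar>a (m + j) - a m\<bar>"
      by simp
    also have "\<dots> \<le> C * (1 + real (m + j)) powr (1/8) + real j * (C * (1 + real (m + j)) powr (1/8))"
      by (intro add_mono inc Suc.IH)
    also have "\<dots> = real (Suc j) * (C * (1 + real (m + j)) powr (1/8))"
      by (simp add: algebra_simps)
    also have "\<dots> \<le> real (Suc j) * (C * (1 + real (m + Suc j)) powr (1/8))"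
      by (intro mult_left_mono mono) simp
    finally show ?case .
  qed simp
  define b where "b n = \<bar>a ((floor_sqrt n)\<^sup>2) / real ((floor_sqrt n)\<^sup>2)\<bar> +
      2 * sqrt (real n) * (C * (1 + real n) powr (1/8)) / real n" for n
  have bound: "\<bar>a n / real n\<bar> \<le> b n" if "n > 0" for n
  proof -
    define k where "k = floor_sqrt n"
    have k: "k\<^sup>2 \<le> n" "0 < k" "n < (Suc k)\<^sup>2"
      using that Suc_floor_sqrt_power2_gt[of n] by (auto simp: k_def)
    have "real k \<le> sqrt (real n)"
      using k(1) by (intro real_le_rsqrt) (metis of_nat_le_iff of_nat_power)
    moreover have "n - k\<^sup>2 \<le> 2 * k"
      using k(3) by (simp add: power2_eq_square)
    ultimately have "real (n - k\<^sup>2) \<le> 2 * sqrt (real n)"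
      by linarith
    then have "\<bar>a n - a (k\<^sup>2)\<bar> \<le> 2 * sqrt (real n) * (C * (1 + real n) powr (1/8))"
    proof (rule order.trans[rotated, OF mult_right_mono])
      show "\<bar>a n - a (k\<^sup>2)\<bar> \<le> real (n - k\<^sup>2) * (C * (1 + real n) powr (1/8))"
        using add[of "k\<^sup>2" "n - k\<^sup>2"] k(1) by (simp only: le_add_diff_inverse)
      show "0 \<le> C * (1 + real n) powr (1/8)"
        using C by simp
    qed
    moreover have "\<bar>a (k\<^sup>2)\<bar> / real n \<le> \<bar>a (k\<^sup>2)\<bar> / real (k\<^sup>2)"
      using k that by (intro divide_left_mono mult_pos_pos) auto
    moreover have "\<bar>a n / real n\<bar> \<le> \<bar>a (k\<^sup>2)\<bar> / real n + \<bar>a n - a (k\<^sup>2)\<bar> / real n"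
      by (simp add: divide_right_mono flip: add_divide_distrib)
    ultimately have "\<bar>a n / real n\<bar> \<le> \<bar>a (k\<^sup>2)\<bar> / real (k\<^sup>2) +
        2 * sqrt (real n) * (C * (1 + real n) powr (1/8)) / real n"
      by (smt (verit) divide_right_mono of_nat_0_le_iff)
    then show ?thesis
      by (simp add: b_def k_def)
  qed
  have "filterlim floor_sqrt at_top at_top"
    unfolding filterlim_at_top
  proof
    fix Z :: nat
    show "\<forall>\<^sub>F n in at_top. Z \<le> floor_sqrt n"
      using eventually_ge_at_top[of "Z\<^sup>2"] by eventually_elim (rule le_floor_sqrtI)
  qed
  then have "(\<lambda>n. \<bar>a ((floor_sqrt n)\<^sup>2) / real ((floor_sqrt n)\<^sup>2)\<bar>) \<longlonglongrightarrow> 0"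
    using tendsto_rabs_zero[OF filterlim_compose[OF sq]] by simp
  moreover have "(\<lambda>n. 2 * sqrt (real n) * (C * (1 + real n) powr (1/8)) / real n) \<longlonglongrightarrow> 0"
    by real_asymp
  ultimately have "b \<longlonglongrightarrow> 0"
    unfolding b_def by (rule tendsto_add_zero)
  then show ?thesis
  proof (rule Lim_null_comparison[rotated])
    show "\<forall>\<^sub>F n in sequentially. norm (a n / real n) \<le> b n"
      using eventually_gt_at_top[of 0] by eventually_elim (simp only: real_norm_def bound)
  qed
qed

text \<open>Along the squares the normalised second moments are \<open>O(k powr (-3/2))\<close>, so
  the sum of the squared ratios has finite expectation and its terms tend to 0 almost surely. The
  increments carry this over to all \<open>n\<close>. With exponent \<open>e\<close> for the
  increments and \<open>1 + 2 * e\<close> for the moments, summability along the squares asks for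
  \<open>e < 1/4\<close>; here \<open>e = 1/8\<close>.\<close>

lemma (in prob_space) AE_LIMSEQ_div_of_second_moments:
  fixes Z :: "nat \<Rightarrow> 'a \<Rightarrow> real"
  assumes [measurable]: "\<And>n. Z n \<in> borel_measurable M"
    and moment: "\<And>n. (\<integral>\<^sup>+x. ennreal ((Z n x)\<^sup>2) \<partial>M) \<le> ennreal (K * (1 + real n) powr (5/4))"
    and inc: "AE x in M. \<exists>C. \<forall>n. \<bar>Z (Suc n) x - Z n x\<bar> \<le> C * (1 + real n) powr (1/8)"
  shows "AE x in M. (\<lambda>n. Z n x / real n) \<longlonglongrightarrow> 0"
proof -
  define c where "c k = \<bar>K\<bar> * (1 + real (k\<^sup>2)) powr (5/4) / (real (k\<^sup>2))\<^sup>2" for k :: nat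
  have c: "summable c"
  proof (rule summable_comparison_test_bigo)
    show "summable (\<lambda>n. norm (real n powr (-3/2)))"
      by (simp add: summable_real_powr_iff)
    show "c \<in> O(\<lambda>n. real n powr (-3/2))"
      unfolding c_def by real_asymp
  qed
  have "(\<integral>\<^sup>+x. (\<Sum>k. ennreal ((Z (k\<^sup>2) x / real (k\<^sup>2))\<^sup>2)) \<partial>M) =
      (\<Sum>k. \<integral>\<^sup>+x. ennreal ((Z (k\<^sup>2) x / real (k\<^sup>2))\<^sup>2) \<partial>M)"
    by (intro nn_integral_suminf) simp
  also have "\<dots> \<le> (\<Sum>k. ennreal (c k))"
  proof (intro suminf_le allI summableI)
    fix k :: nat
    show "(\<integral>\<^sup>+x. ennreal ((Z (k\<^sup>2) x / real (k\<^sup>2))\<^sup>2) \<partial>M) \<le> ennreal (c k)"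
    \<comment> \<open>For \<open>k = 0\<close> both sides are 0, since division by zero yields
      0.\<close>
    proof (cases "k = 0")
      case False
      have "(\<integral>\<^sup>+x. ennreal ((Z (k\<^sup>2) x / real (k\<^sup>2))\<^sup>2) \<partial>M) =
          (\<integral>\<^sup>+x. ennreal (1 / (real (k\<^sup>2))\<^sup>2) * ennreal ((Z (k\<^sup>2) x)\<^sup>2) \<partial>M)"
        by (intro nn_integral_cong) (simp add: power_divide flip: ennreal_mult')
      also have "\<dots> = ennreal (1 / (real (k\<^sup>2))\<^sup>2) * (\<integral>\<^sup>+x. ennreal ((Z (k\<^sup>2) x)\<^sup>2) \<partial>M)"
        by (intro nn_integral_cmult) simp
      also have "\<dots> \<le> ennreal (1 / (real (k\<^sup>2))\<^sup>2) * ennreal (K * (1 + real (k\<^sup>2)) powr (5/4))"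
        by (intro mult_left_mono moment) simp
      also have "\<dots> \<le> ennreal (c k)"
        unfolding c_def
        by (subst ennreal_mult'[symmetric], simp, intro ennreal_leI)
          (simp add: divide_right_mono mult_right_mono)
      finally show ?thesis .
    qed simp
  qed
  also have "\<dots> < \<infinity>"
  proof -
    have "0 \<le> c k" for k
      by (simp add: c_def)
    then show ?thesis
      by (simp add: suminf_ennreal2[OF _ c])
  qed
  finally have "AE x in M. (\<Sum>k. ennreal ((Z (k\<^sup>2) x / real (k\<^sup>2))\<^sup>2)) \<noteq> \<infinity>"
    by (intro nn_integral_PInf_AE) auto
  then show ?thesis
    using inc
  proof eventually_elim
    case (elim x)
    then obtain C where C: "\<And>n. \<bar>Z (Suc n) x - Z n x\<bar> \<le> C * (1 + real n) powr (1/8)"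
      by auto
    have "summable (\<lambda>k. (Z (k\<^sup>2) x / real (k\<^sup>2))\<^sup>2)"
      using elim(1) by (intro summable_suminf_not_top) auto
    then have "(\<lambda>k. sqrt ((Z (k\<^sup>2) x / real (k\<^sup>2))\<^sup>2)) \<longlonglongrightarrow> sqrt 0"
      by (intro tendsto_real_sqrt summable_LIMSEQ_zero)
    then have "(\<lambda>k. \<bar>Z (k\<^sup>2) x / real (k\<^sup>2)\<bar>) \<longlonglongrightarrow> 0"
      by (simp only: real_sqrt_abs real_sqrt_zero)
    then have "(\<lambda>k. Z (k\<^sup>2) x / real (k\<^sup>2)) \<longlonglongrightarrow> 0"
      by (rule tendsto_rabs_zero_cancel)
    then show ?case
      using C by (rule LIMSEQ_div_of_squares)
  qed
qed

section \<open>One-dimensional marginals of a Markov chain\<close>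

text \<open>Moments at a fixed time can be computed with this recursion instead of on the path
  space; \<open>distr_markov_law\<close> links the two.\<close>

primrec marginal_pmf :: "('a \<Rightarrow> 'a pmf) \<Rightarrow> 'a \<Rightarrow> nat \<Rightarrow> 'a pmf" where
  "marginal_pmf K x 0 = return_pmf x"
| "marginal_pmf K x (Suc n) = bind_pmf (marginal_pmf K x n) K"

lemma sets_markov_law_cylinder: "{w. \<forall>i\<le>n. w i = f i} \<in> sets (markov_law K x)"
  unfolding cylinder_eq_emb sets_markov_law
  by (rule measurable_prod_emb) (auto intro: singleton_in_sets_PiM)

lemma measurable_markov_law_coordinate [measurable]:
  "(\<lambda>w. w n) \<in> markov_law K x \<rightarrow>\<^sub>M count_space UNIV"
  unfolding measurable_cong_sets[OF sets_markov_law refl] by measurable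

text \<open>The event is split according to the history up to time \<open>n\<close>. There are
  countably many histories, and prolonging a cylinder that ends in \<open>y\<close> by
  \<open>z\<close> multiplies its measure by the same factor each time.\<close>

lemma emeasure_markov_law_step:
  fixes K :: "'a :: countable \<Rightarrow> 'a pmf"
  shows "emeasure (markov_law K x) {w. w n = y \<and> w (Suc n) = z} =
    emeasure (markov_law K x) {w. w n = y} * ennreal (pmf (K y) z)"
proof -
  \<comment> \<open>Extensional functions represent each history exactly once, which makes the
    cylinders disjoint and the index set countable.\<close>
  define F where "F = {f \<in> PiE {0..<Suc n} (\<lambda>_. UNIV :: 'a set). f n = y}"
  let ?c = "\<lambda>n f. {w. \<forall>i\<le>n. w i = f i}"
  have F: "countable F"
    unfolding F_def by (rule countable_subset[OF _ countable_PiE[of "{0..<Suc n}" "\<lambda>_. UNIV"]]) auto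
  have disj: "disjoint_family_on (?c n) F"
  proof (unfold disjoint_family_on_def, safe)
    fix f g w assume fg: "f \<in> F" "g \<in> F" "\<forall>i\<le>n. w i = f i" "\<forall>i\<le>n. w i = g i" "f \<noteq> g"
    have "f i = g i" for i
      using fg by (cases "i \<le> n") (auto simp: F_def PiE_def extensional_def)
    with \<open>f \<noteq> g\<close> show "w \<in> {}" by auto
  qed
  have disj': "disjoint_family_on (\<lambda>f. ?c (Suc n) (f(Suc n := z))) F"
  proof -
    have "?c (Suc n) (f(Suc n := z)) \<subseteq> ?c n f" for f
      by auto
    then show ?thesis
      using disj unfolding disjoint_family_on_def by (metis (no_types, lifting) Int_mono subset_empty)
  qed
  have "{w. w n = y} = (\<Union>f\<in>F. ?c n f)"
  proof safe
    fix w :: "nat \<Rightarrow> 'a"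
    assume "y = w n"
    then show "w \<in> (\<Union>f\<in>F. ?c n f)"
      by (intro UN_I[of "restrict w {0..<Suc n}"]) (auto simp: F_def)
  qed (auto simp: F_def)
  then have 1: "emeasure (markov_law K x) {w. w n = y} =
      (\<integral>\<^sup>+f. emeasure (markov_law K x) (?c n f) \<partial>count_space F)"
    by (simp only:) (intro emeasure_UN_countable F disj sets_markov_law_cylinder)
  have "{w. w n = y \<and> w (Suc n) = z} = (\<Union>f\<in>F. ?c (Suc n) (f(Suc n := z)))"
  proof safe
    fix w :: "nat \<Rightarrow> 'a"
    assume "y = w n" "z = w (Suc n)"
    then show "w \<in> (\<Union>f\<in>F. ?c (Suc n) (f(Suc n := w (Suc n))))"
      by (intro UN_I[of "restrict w {0..<Suc n}"]) (auto simp: F_def)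
  qed (force simp: F_def)+
  then have "emeasure (markov_law K x) {w. w n = y \<and> w (Suc n) = z} =
      (\<integral>\<^sup>+f. emeasure (markov_law K x) (?c (Suc n) (f(Suc n := z))) \<partial>count_space F)"
    by (simp only:) (intro emeasure_UN_countable F disj' sets_markov_law_cylinder)
  also have "\<dots> = (\<integral>\<^sup>+f. emeasure (markov_law K x) (?c n f) * ennreal (pmf (K y) z) \<partial>count_space F)"
  proof (intro nn_integral_cong)
    fix f assume "f \<in> space (count_space F)"
    then have "f n = y"
      by (simp add: F_def)
    then show "emeasure (markov_law K x) (?c (Suc n) (f(Suc n := z))) =
        emeasure (markov_law K x) (?c n f) * ennreal (pmf (K y) z)"
      unfolding emeasure_markov_law_cylinder by (simp add: prod_nonneg ennreal_mult)
  qed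
  also have "\<dots> = emeasure (markov_law K x) {w. w n = y} * ennreal (pmf (K y) z)"
    unfolding 1 by (intro nn_integral_multc) simp
  finally show ?thesis .
qed

lemma emeasure_markov_law_single:
  fixes K :: "'a :: countable \<Rightarrow> 'a pmf"
  shows "emeasure (markov_law K x) {w. w n = z} = ennreal (pmf (marginal_pmf K x n) z)"
proof (induction n arbitrary: z)
  case 0
  show ?case
    using emeasure_markov_law_cylinder[of K x 0 "\<lambda>_. z"] by (simp add: indicator_def)
next
  case (Suc n)
  have "{w. w (Suc n) = z} = (\<Union>y. {w. w n = y \<and> w (Suc n) = z})"
    by auto
  also have "emeasure (markov_law K x) \<dots> =
      (\<integral>\<^sup>+y. emeasure (markov_law K x) {w. w n = y \<and> w (Suc n) = z} \<partial>count_space UNIV)"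
  proof (rule emeasure_UN_countable)
    have "{w \<in> space (markov_law K x). w n = y \<and> w (Suc n) = z} \<in> sets (markov_law K x)" for y
      by measurable
    then show "{w. w n = y \<and> w (Suc n) = z} \<in> sets (markov_law K x)" for y
      by simp
  qed (auto simp: disjoint_family_on_def)
  also have "\<dots> = (\<integral>\<^sup>+y. ennreal (pmf (K y) z) \<partial>measure_pmf (marginal_pmf K x n))"
    unfolding emeasure_markov_law_step Suc.IH by (simp add: nn_integral_measure_pmf)
  finally show ?case
    by (simp add: ennreal_pmf_bind)
qed

lemma distr_markov_law:
  fixes K :: "'a :: countable \<Rightarrow> 'a pmf"
  shows "distr (markov_law K x) (count_space UNIV) (\<lambda>w. w n) = measure_pmf (marginal_pmf K x n)"
proof (rule measure_eqI_countable[of _ UNIV])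
  fix a :: 'a
  have "emeasure (distr (markov_law K x) (count_space UNIV) (\<lambda>w. w n)) {a} =
      emeasure (markov_law K x) {w. w n = a}"
    by (subst emeasure_distr) (auto simp: vimage_def)
  then show "emeasure (distr (markov_law K x) (count_space UNIV) (\<lambda>w. w n)) {a} =
      emeasure (measure_pmf (marginal_pmf K x n)) {a}"
    by (simp add: emeasure_markov_law_single emeasure_pmf_single)
qed auto

text \<open>A forbidden transition from \<open>y\<close> to \<open>z\<close> at time
  \<open>n\<close> has probability 0, and there are only countably many triples
  \<open>(n, y, z)\<close>.\<close>

lemma AE_markov_law_step:
  fixes K :: "'a :: countable \<Rightarrow> 'a pmf"
  shows "AE w in markov_law K x. w 0 = x \<and> (\<forall>n. w (Suc n) \<in> set_pmf (K (w n)))"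
proof -
  have *: "AE w in markov_law K x. \<not> (w n = y \<and> w (Suc n) = z)" if "z \<notin> set_pmf (K y)" for n y z
  proof (rule AE_I')
    have "{w \<in> space (markov_law K x). w n = y \<and> w (Suc n) = z} \<in> sets (markov_law K x)"
      by measurable
    then show "{w. w n = y \<and> w (Suc n) = z} \<in> null_sets (markov_law K x)"
      using that by (simp add: null_sets_def emeasure_markov_law_step set_pmf_iff)
  qed auto
  then have "AE w in markov_law K x. \<forall>n y z. z \<notin> set_pmf (K y) \<longrightarrow> \<not> (w n = y \<and> w (Suc n) = z)"
    unfolding AE_all_countable
  proof (intro allI)
    show "AE w in markov_law K x. z \<notin> set_pmf (K y) \<longrightarrow> \<not> (w n = y \<and> w (Suc n) = z)" for n y z
      using *[of z y n] by (cases "z \<in> set_pmf (K y)") simp_all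
  qed
  moreover have "AE w in markov_law K x. w 0 = x"
  proof -
    have "measure (markov_law K x) {w. w 0 = x} = 1"
      by (simp add: measure_def emeasure_markov_law_single)
    from prob_space.AE_prob_1[OF prob_space_markov_law this] show ?thesis
      by simp
  qed
  ultimately show ?thesis
    by eventually_elim blast
qed


section \<open>The walk in a fixed environment\<close>

text \<open>Index 0 counts as a barrier whatever \<open>\<sigma> 0\<close> is. The same function
  thus applies to a random sequence whose first entry is unrestricted.\<close>

primrec run_length :: "(nat \<Rightarrow> bool) \<Rightarrow> nat \<Rightarrow> nat" where
  "run_length \<sigma> 0 = 0"
| "run_length \<sigma> (Suc y) = (if \<sigma> (Suc y) then Suc (run_length \<sigma> y) else 0)"

text \<open>This is the \<phi> of the overview: the mean time to reach \<open>y\<close> from the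
  barrier at 0. It solves the Poisson equation saying that one step of the walk raises \<phi> by 1
  on average.\<close>

definition corrector :: "(nat \<Rightarrow> bool) \<Rightarrow> nat \<Rightarrow> real" where
  "corrector \<sigma> y = (\<Sum>i<y. 1 + 2 * real (run_length \<sigma> i))"

lemma corrector_Suc: "corrector \<sigma> (Suc y) = corrector \<sigma> y + 1 + 2 * real (run_length \<sigma> y)"
  by (simp add: corrector_def)

lemma mono_corrector: "x \<le> y \<Longrightarrow> corrector \<sigma> x \<le> corrector \<sigma> y"
  unfolding corrector_def by (rule sum_mono2) auto

text \<open>
  The origin of the lattice has index \<open>L\<close>. Only the sites from the barrier at index \<open>0\<close> on matter:
  nothing is assumed about \<open>g\<close> elsewhere.
\<close>

locale half_line_environment =
  fixes g :: environment and L :: nat and \<sigma> :: "nat \<Rightarrow> bool" and p C :: real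
  assumes g: "g (int y - int L, 0) = (if \<sigma> y then {e1, - e1} else {e1})"
    and not_\<sigma>_0: "\<not> \<sigma> 0"
    and p: "0 < p" "p < 1"
    and run_length_bound: "real (run_length \<sigma> y) \<le> C * (1 + real y) powr (1/8)"
    and run_length_mean: "(\<lambda>N. (\<Sum>i<N. real (run_length \<sigma> i)) / real N) \<longlonglongrightarrow> p / (1 - p)"
begin

definition site :: "nat \<Rightarrow> int \<times> int" where
  "site y = (int y - int L, 0)"

text \<open>The corrector as a total function on the lattice; \<open>nat\<close> sends everything
  left of the barrier, where the walk never goes, to index 0.\<close>

definition height :: "int \<times> int \<Rightarrow> real" where
  "height z = corrector \<sigma> (nat (fst z + int L))"

lemma height_site [simp]: "height (site y) = corrector \<sigma> y"
  by (simp add: height_def site_def)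

section \<open>Reachable sites and second moments of the height\<close>

lemma C_nonneg: "0 \<le> C"
  using run_length_bound[of 0] by simp

lemma walk_step_one_way: "\<not> \<sigma> y \<Longrightarrow> walk_step g (site y) = return_pmf (site (Suc y))"
  using g[of y] by (simp add: walk_step_def site_def pmf_of_set_singleton e1_def)

lemma walk_step_two_way:
  "\<sigma> (Suc y) \<Longrightarrow> walk_step g (site (Suc y)) = pmf_of_set {site (Suc (Suc y)), site y}"
  using g[of "Suc y"] by (simp add: walk_step_def site_def e1_def map_pmf_of_set_inj algebra_simps)

lemma site_inject [simp]: "site x = site y \<longleftrightarrow> x = y"
  by (simp add: site_def)

text \<open>The subtraction \<open>y - 1\<close> is never truncated: a two-way site has
  \<open>y > 0\<close> because index 0 is a barrier.\<close>

lemma set_pmf_walk_step: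
  "set_pmf (walk_step g (site y)) = (if \<sigma> y then {site (Suc y), site (y - 1)} else {site (Suc y)})"
  using not_\<sigma>_0 by (cases y) (auto simp: walk_step_one_way walk_step_two_way)

lemma site_origin: "0 = site L"
  by (simp add: site_def zero_prod_def)

text \<open>The walk starts at index \<open>L\<close>, cannot pass the barrier and advances by at
  most one site per step. Hence only run lengths at indices up to \<open>n + L\<close> matter at
  time \<open>n\<close>.\<close>

lemma set_pmf_marginal: "set_pmf (marginal_pmf (walk_step g) 0 n) \<subseteq> site ` {..n + L}"
proof (induction n)
  case (Suc n)
  show ?case
  proof
    fix z assume "z \<in> set_pmf (marginal_pmf (walk_step g) 0 (Suc n))"
    then obtain x where "x \<in> set_pmf (marginal_pmf (walk_step g) 0 n)" "z \<in> set_pmf (walk_step g x)"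
      by auto
    with Suc.IH obtain y where "y \<le> n + L" "z \<in> set_pmf (walk_step g (site y))"
      by blast
    then show "z \<in> site ` {..Suc n + L}"
      by (auto simp: set_pmf_walk_step split: if_splits)
  qed
qed (simp add: site_origin)

text \<open>At a two-way site \<open>height\<close> minus time changes by plus or minus
  \<open>2 * run_length \<sigma> y\<close> with equal probability, so the cross term of the square
  cancels. At a one-way site both the change and the run length are 0.\<close>

lemma nn_integral_walk_step:
  "(\<integral>\<^sup>+z. ennreal ((height z - (t + 1))\<^sup>2) \<partial>walk_step g (site y)) =
     ennreal ((corrector \<sigma> y - t)\<^sup>2) + ennreal (4 * (real (run_length \<sigma> y))\<^sup>2)"
proof (cases "\<sigma> y")
  case True
  then obtain m where y: "y = Suc m"
    using not_\<sigma>_0 by (cases y) auto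
  have "(\<integral>\<^sup>+z. ennreal ((height z - (t + 1))\<^sup>2) \<partial>walk_step g (site y)) =
      (ennreal ((corrector \<sigma> (Suc y) - (t + 1))\<^sup>2) + ennreal ((corrector \<sigma> m - (t + 1))\<^sup>2)) / 2"
    using True unfolding y by (simp add: walk_step_two_way nn_integral_pmf_of_set)
  also have "\<dots> = ennreal (((corrector \<sigma> (Suc y) - (t + 1))\<^sup>2 + (corrector \<sigma> m - (t + 1))\<^sup>2) / 2)"
    by (simp add: ennreal_plus flip: divide_ennreal)
  also have "((corrector \<sigma> (Suc y) - (t + 1))\<^sup>2 + (corrector \<sigma> m - (t + 1))\<^sup>2) / 2 =
      (corrector \<sigma> y - t)\<^sup>2 + 4 * (real (run_length \<sigma> y))\<^sup>2"
    using True unfolding y by (simp add: corrector_Suc power2_eq_square field_simps)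
  finally show ?thesis
    by (simp add: ennreal_plus)
next
  case False
  then have "run_length \<sigma> y = 0"
    by (cases y) auto
  with False show ?thesis
    by (simp add: walk_step_one_way corrector_Suc)
qed

text \<open>The squared increment at step \<open>n\<close> is \<open>O((1 + n) powr (1/4))\<close>,
  and summing over the steps raises the exponent by 1. The start contributes the constant
  \<open>(corrector \<sigma> L)\<^sup>2\<close>.\<close>

lemma second_moment_height:
  "(\<integral>\<^sup>+z. ennreal ((height z - real n)\<^sup>2) \<partial>marginal_pmf (walk_step g) 0 n) \<le>
     ennreal (((corrector \<sigma> L)\<^sup>2 + 4 * C\<^sup>2 * (1 + real L) powr (1/4)) * (1 + real n) powr (5/4))"
proof (induction n)
  case 0
  show ?case
    by (simp add: site_origin)
next
  case (Suc n)
  let ?\<mu> = "marginal_pmf (walk_step g) 0 n"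
  \<comment> \<open>The factor with \<open>L\<close> absorbs the shift of the origin, by
    \<open>1 + n + L \<le> (1 + L) * (1 + n)\<close>.\<close>
  define D where "D = 4 * C\<^sup>2 * (1 + real L) powr (1/4)"
  define K where "K = (corrector \<sigma> L)\<^sup>2 + D"
  have D: "0 \<le> D"
    by (simp add: D_def)
  have run: "4 * (real (run_length \<sigma> y))\<^sup>2 \<le> D * (1 + real n) powr (1/4)" if "y \<le> n + L" for y
  proof -
    have "real (run_length \<sigma> y) \<le> C * ((1 + real L) * (1 + real n)) powr (1/8)"
    proof (rule order.trans[OF run_length_bound])
      have "1 + real y \<le> 1 + real n + real L"
        using that by simp
      also have "\<dots> \<le> (1 + real L) * (1 + real n)"
        by (simp add: algebra_simps)
      finally show "C * (1 + real y) powr (1/8) \<le> C * ((1 + real L) * (1 + real n)) powr (1/8)"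
        by (intro mult_left_mono powr_mono2 C_nonneg) auto
    qed
    then have "(real (run_length \<sigma> y))\<^sup>2 \<le> (C * ((1 + real L) * (1 + real n)) powr (1/8))\<^sup>2"
      by (intro power_mono) auto
    also have "\<dots> = C\<^sup>2 * ((1 + real L) * (1 + real n)) powr (1/4)"
      by (simp add: power_mult_distrib power2_eq_square flip: powr_add)
    also have "\<dots> = C\<^sup>2 * ((1 + real L) powr (1/4) * (1 + real n) powr (1/4))"
      by (subst powr_mult) auto
    finally show ?thesis
      by (simp add: D_def algebra_simps)
  qed
  have "(\<integral>\<^sup>+z. ennreal ((height z - real (Suc n))\<^sup>2) \<partial>marginal_pmf (walk_step g) 0 (Suc n)) =
      (\<integral>\<^sup>+x. \<integral>\<^sup>+z. ennreal ((height z - (real n + 1))\<^sup>2) \<partial>walk_step g x \<partial>?\<mu>)"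
    by (simp add: algebra_simps)
  also have "\<dots> \<le> (\<integral>\<^sup>+x. ennreal ((height x - real n)\<^sup>2) + ennreal (D * (1 + real n) powr (1/4)) \<partial>?\<mu>)"
  proof (intro nn_integral_mono_AE AE_pmfI)
    fix x assume "x \<in> set_pmf ?\<mu>"
    then obtain y where "y \<le> n + L" "x = site y"
      using set_pmf_marginal by blast
    then show "(\<integral>\<^sup>+z. ennreal ((height z - (real n + 1))\<^sup>2) \<partial>walk_step g x) \<le>
        ennreal ((height x - real n)\<^sup>2) + ennreal (D * (1 + real n) powr (1/4))"
      using run by (simp add: nn_integral_walk_step) (intro add_left_mono ennreal_leI, simp)
  qed
  also have "\<dots> = (\<integral>\<^sup>+x. ennreal ((height x - real n)\<^sup>2) \<partial>?\<mu>) + ennreal (D * (1 + real n) powr (1/4))"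
    by (subst nn_integral_add) (simp_all add: measure_pmf.emeasure_space_1)
  also have "\<dots> \<le> ennreal (K * (1 + real n) powr (5/4)) + ennreal (D * (1 + real n) powr (1/4))"
    using Suc.IH by (intro add_right_mono) (simp add: K_def D_def)
  also have "\<dots> = ennreal (K * (1 + real n) powr (5/4) + D * (1 + real n) powr (1/4))"
    using D by (simp add: ennreal_plus K_def)
  also have "\<dots> \<le> ennreal (K * (1 + real (Suc n)) powr (5/4))"
  proof (rule ennreal_leI)
    have split: "x powr (5/4) = x * x powr (1/4)" if "x > 0" for x :: real
      using that powr_add[of x 1 "1/4"] by simp
    \<comment> \<open>Since \<open>D \<le> K\<close>, the sum is at most
      \<open>K * (2 + n) * (1 + n) powr (1/4)\<close>, and \<open>2 + n\<close> is
      \<open>1 + Suc n\<close>.\<close>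
    have "K * (1 + real n) powr (5/4) + D * (1 + real n) powr (1/4) \<le>
        K * (1 + real n) powr (5/4) + K * (1 + real n) powr (1/4)"
      by (intro add_left_mono mult_right_mono) (auto simp: K_def)
    also have "\<dots> = K * ((1 + real (Suc n)) * (1 + real n) powr (1/4))"
      by (simp add: split algebra_simps)
    also have "\<dots> \<le> K * ((1 + real (Suc n)) * (1 + real (Suc n)) powr (1/4))"
      using D by (intro mult_left_mono powr_mono2) (auto simp: K_def)
    also have "\<dots> = K * (1 + real (Suc n)) powr (5/4)"
      by (simp add: split)
    finally show "K * (1 + real n) powr (5/4) + D * (1 + real n) powr (1/4) \<le>
        K * (1 + real (Suc n)) powr (5/4)" .
  qed
  finally show ?case
    by (simp add: K_def D_def)
qed

section \<open>Sample paths and the speed in a fixed environment\<close>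

lemma AE_path:
  "AE X in quenched_law g. \<exists>y. y 0 = L \<and> (\<forall>n. X n = site (y n)) \<and>
     (\<forall>n. y (Suc n) = Suc (y n) \<or> (\<sigma> (y n) \<and> Suc (y (Suc n)) = y n))"
  using AE_markov_law_step[where K = "walk_step g" and x = 0] unfolding quenched_law_def
proof eventually_elim
  case (elim X)
  define y where "y n = nat (fst (X n) + int L)" for n
  have site: "X n = site (y n)" for n
  proof (induction n)
    case 0
    show ?case
      using elim by (simp add: y_def site_def zero_prod_def)
  next
    case (Suc n)
    have "X (Suc n) \<in> set_pmf (walk_step g (site (y n)))"
      using elim Suc.IH by metis
    then obtain m where "X (Suc n) = site m"
      by (auto simp: set_pmf_walk_step split: if_splits)
    then show ?case
      by (simp add: y_def[of "Suc n"] site_def)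
  qed
  have "y (Suc n) = Suc (y n) \<or> (\<sigma> (y n) \<and> Suc (y (Suc n)) = y n)" for n
  proof -
    have "site (y (Suc n)) \<in> set_pmf (walk_step g (site (y n)))"
      using elim site by metis
    then show ?thesis
      using not_\<sigma>_0 by (cases "y n") (auto simp: set_pmf_walk_step split: if_splits)
  qed
  moreover have "y 0 = L"
    using elim by (simp add: y_def)
  ultimately show ?case
    using site by blast
qed

lemma corrector_asymp: "(\<lambda>y. corrector \<sigma> y / real y) \<longlonglongrightarrow> (1 + p) / (1 - p)"
proof -
  have "(\<lambda>y. 1 + 2 * ((\<Sum>i<y. real (run_length \<sigma> i)) / real y)) \<longlonglongrightarrow> 1 + 2 * (p / (1 - p))"
    by (intro tendsto_intros run_length_mean)
  moreover have "1 + 2 * (p / (1 - p)) = (1 + p) / (1 - p)"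
    using p by (simp add: field_simps)
  moreover have "\<forall>\<^sub>F y in sequentially.
      1 + 2 * ((\<Sum>i<y. real (run_length \<sigma> i)) / real y) = corrector \<sigma> y / real y"
    using eventually_gt_at_top[of 0]
    by eventually_elim (simp add: corrector_def sum.distrib sum_distrib_left field_simps)
  ultimately show ?thesis
    using Lim_transform_eventually by fastforce
qed

text \<open>The strong law applies to the martingale \<open>height (X n) - n\<close>. Its second
  moment only involves the marginal at time \<open>n\<close>, while the bound on the increments is
  read off the path.\<close>

lemma AE_height_asymp: "AE X in quenched_law g. (\<lambda>n. (height (X n) - real n) / real n) \<longlonglongrightarrow> 0"
proof -
  interpret prob_space "quenched_law g"
    unfolding quenched_law_def by (rule prob_space_markov_law)
  show ?thesis
  proof (rule AE_LIMSEQ_div_of_second_moments)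
    have [measurable]: "(\<lambda>X. X n) \<in> quenched_law g \<rightarrow>\<^sub>M count_space UNIV" for n
      unfolding quenched_law_def by measurable
    show "(\<lambda>X. height (X n) - real n) \<in> borel_measurable (quenched_law g)" for n
      by measurable
    show "(\<integral>\<^sup>+X. ennreal ((height (X n) - real n)\<^sup>2) \<partial>quenched_law g) \<le>
        ennreal (((corrector \<sigma> L)\<^sup>2 + 4 * C\<^sup>2 * (1 + real L) powr (1/4)) * (1 + real n) powr (5/4))" for n
    proof -
      have "(\<integral>\<^sup>+X. ennreal ((height (X n) - real n)\<^sup>2) \<partial>quenched_law g) =
          (\<integral>\<^sup>+z. ennreal ((height z - real n)\<^sup>2) \<partial>distr (quenched_law g) (count_space UNIV) (\<lambda>X. X n))"
        by (subst nn_integral_distr) auto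
      then show ?thesis
        using second_moment_height[of n] by (simp add: quenched_law_def distr_markov_law)
    qed
    show "AE X in quenched_law g. \<exists>C. \<forall>n.
        \<bar>height (X (Suc n)) - real (Suc n) - (height (X n) - real n)\<bar> \<le> C * (1 + real n) powr (1/8)"
      using AE_path
    proof eventually_elim
      case (elim X)
      then obtain y where y: "y 0 = L" "\<And>n. X n = site (y n)"
        "\<And>n. y (Suc n) = Suc (y n) \<or> (\<sigma> (y n) \<and> Suc (y (Suc n)) = y n)"
        by blast
      have le: "y n \<le> n + L" for n
      proof (induction n)
        case (Suc n)
        then show ?case
          using y(3)[of n] by auto
      qed (simp add: y)
      have "\<bar>height (X (Suc n)) - real (Suc n) - (height (X n) - real n)\<bar> \<le>
          (2 * C * (1 + real L) powr (1/8)) * (1 + real n) powr (1/8)" for n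
      proof -
        have "\<bar>height (X (Suc n)) - real (Suc n) - (height (X n) - real n)\<bar> \<le>
            2 * real (run_length \<sigma> (y n))"
          using y(3)[of n]
        proof
          assume "\<sigma> (y n) \<and> Suc (y (Suc n)) = y n"
          then have "\<sigma> (Suc (y (Suc n)))" "y n = Suc (y (Suc n))"
            by auto
          then show ?thesis
            by (simp add: y(2) corrector_Suc)
        qed (simp add: y(2) corrector_Suc)
        also have "\<dots> \<le> 2 * (C * (1 + real (y n)) powr (1/8))"
          by (intro mult_left_mono run_length_bound) simp
        also have "\<dots> \<le> 2 * (C * ((1 + real L) * (1 + real n)) powr (1/8))"
        proof (intro mult_left_mono powr_mono2 C_nonneg)
          have "1 + real (y n) \<le> 1 + real n + real L"
            using le[of n] by simp
          also have "\<dots> \<le> (1 + real L) * (1 + real n)"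
            by (simp add: algebra_simps)
          finally show "1 + real (y n) \<le> (1 + real L) * (1 + real n)" .
        qed auto
        finally show ?thesis
          by (simp add: powr_mult mult.assoc)
      qed
      then show ?case
        by blast
    qed
  qed
qed

text \<open>Writing \<open>y n\<close> for the index of the walk, the limit 1 of
  \<phi>\<open>(y n) / n\<close> is divided by the limit of \<phi>\<open>(y n) / y n\<close>. The
  latter comes from \<open>corrector_asymp\<close> once \<open>y n\<close> is known to
  diverge.\<close>

lemma AE_walk_asymp:
  "AE X in quenched_law g. (\<lambda>n. inverse (real n) *\<^sub>R map_prod real_of_int real_of_int (X n))
     \<longlonglongrightarrow> ((1 - p) / (1 + p), 0)"
  using AE_path AE_height_asymp
proof eventually_elim
  case (elim X)
  then obtain y where y: "\<And>n. X n = site (y n)"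
    by blast
  have "(\<lambda>n. (corrector \<sigma> (y n) - real n) / real n) \<longlonglongrightarrow> 0"
    using elim(2) by (simp only: y height_site)
  from tendsto_add[OF this tendsto_const[of 1]]
  have cor: "(\<lambda>n. corrector \<sigma> (y n) / real n) \<longlonglongrightarrow> 1"
    unfolding add_0
  proof (rule Lim_transform_eventually)
    show "\<forall>\<^sub>F n in sequentially. (corrector \<sigma> (y n) - real n) / real n + 1 = corrector \<sigma> (y n) / real n"
      using eventually_gt_at_top[of 0] by eventually_elim (simp add: field_simps)
  qed
  \<comment> \<open>Divergence follows from the martingale limit: the corrector at
    \<open>y n\<close> grows like \<open>n\<close>, so it eventually exceeds its value at any fixed
    \<open>Y\<close>, and it is monotone.\<close>
  have top: "filterlim y at_top sequentially"
    unfolding filterlim_at_top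
  proof
    fix Y :: nat
    have "(\<lambda>n. corrector \<sigma> Y / real n) \<longlonglongrightarrow> 0"
      by (rule lim_const_over_n)
    then have "\<forall>\<^sub>F n in sequentially. corrector \<sigma> Y / real n < 1/2"
      by (rule order_tendstoD) simp
    moreover have "\<forall>\<^sub>F n in sequentially. 1/2 < corrector \<sigma> (y n) / real n"
      using cor by (rule order_tendstoD) simp
    ultimately show "\<forall>\<^sub>F n in sequentially. Y \<le> y n"
      using eventually_gt_at_top[of 0]
    proof eventually_elim
      case (elim n)
      then have "corrector \<sigma> Y < corrector \<sigma> (y n)"
        by (smt (verit) divide_right_mono of_nat_0_le_iff)
      then show "Y \<le> y n"
        using mono_corrector[of "y n" Y \<sigma>] by (cases "Y \<le> y n") auto
    qed
  qed
  have "(\<lambda>n. (corrector \<sigma> (y n) / real n) / (corrector \<sigma> (y n) / real (y n))) \<longlonglongrightarrow> 1 / ((1 + p) / (1 - p))"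
    using p by (intro tendsto_divide cor filterlim_compose[OF corrector_asymp top]) auto
  then have lim: "(\<lambda>n. real (y n) / real n) \<longlonglongrightarrow> 1 / ((1 + p) / (1 - p))"
  proof (rule Lim_transform_eventually)
    have "\<forall>\<^sub>F n in sequentially. 0 < y n"
      using top unfolding filterlim_at_top by (auto simp: Suc_le_eq dest: spec[of _ 1])
    then show "\<forall>\<^sub>F n in sequentially.
        (corrector \<sigma> (y n) / real n) / (corrector \<sigma> (y n) / real (y n)) = real (y n) / real n"
    proof eventually_elim
      case (elim n)
      \<comment> \<open>The value at 1 is 1, so the quotient may be cancelled.\<close>
      have "corrector \<sigma> 1 \<le> corrector \<sigma> (y n)"
        using elim by (intro mono_corrector) simp
      then have "corrector \<sigma> (y n) \<noteq> 0"
        by (simp add: corrector_def)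
      then show ?case
        by simp
    qed
  qed
  have "(\<lambda>n. real (y n) / real n - real L / real n) \<longlonglongrightarrow> 1 / ((1 + p) / (1 - p)) - 0"
    by (intro tendsto_diff lim lim_const_over_n)
  then have "(\<lambda>n. (real (y n) / real n - real L / real n, 0 :: real)) \<longlonglongrightarrow> ((1 - p) / (1 + p), 0)"
    by (intro tendsto_Pair) auto
  moreover have "inverse (real n) *\<^sub>R map_prod real_of_int real_of_int (X n) =
      (real (y n) / real n - real L / real n, 0)" for n
    by (simp add: y site_def divide_inverse algebra_simps)
  ultimately show ?case
    by simp
qed

end


section \<open>Runs of two-way sites\<close>

lemma run_length_cong: "(\<And>i. i \<le> n \<Longrightarrow> x i = y i) \<Longrightarrow> run_length x n = run_length y n"
  by (induction n) auto

text \<open>Here \<open>X i\<close> says that the \<open>i\<close>-th site of some half-line of the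
  axis is two-way. The locale is used for half-lines to the right from every possible barrier, and
  for the one to the left from the origin.\<close>

locale bernoulli_sequence = prob_space +
  fixes X :: "nat \<Rightarrow> 'a \<Rightarrow> bool" and p :: real
  assumes indep: "indep_vars (\<lambda>_. count_space UNIV) X UNIV"
    and prob_X: "\<And>i. prob {\<omega> \<in> space M. X i \<omega>} = p"
    and p: "0 < p" "p < 1"
begin

lemma measurable_X [measurable]: "X i \<in> M \<rightarrow>\<^sub>M count_space UNIV"
  using indep by (simp add: indep_vars_def)

lemma expectation_X: "expectation (\<lambda>\<omega>. of_bool (X i \<omega>)) = p"
proof -
  have "expectation (\<lambda>\<omega>. of_bool (X i \<omega>) :: real) = expectation (indicator {\<omega> \<in> space M. X i \<omega>})"
    by (intro Bochner_Integration.integral_cong) (auto simp: indicator_def)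
  then show ?thesis
    by (simp add: prob_X)
qed

text \<open>The condition on \<open>F\<close> takes the place of adaptedness to a filtration. Since
  the coordinates up to \<open>n\<close> take only finitely many values, measurability and
  boundedness come for free.\<close>

context
  fixes F :: "(nat \<Rightarrow> bool) \<Rightarrow> real" and n :: nat
  assumes F: "\<And>x y. (\<And>i. i \<le> n \<Longrightarrow> x i = y i) \<Longrightarrow> F x = F y"
begin

lemma measurable_prefix_PiM: "F \<in> borel_measurable (PiM {0..<Suc n} (\<lambda>_. count_space UNIV))"
proof (rule measurableI)
  let ?P = "PiM {0..<Suc n} (\<lambda>_. count_space (UNIV :: bool set))"
  fix A :: "real set"
  have fin: "finite (space ?P)"
    by (simp add: space_PiM finite_PiE)
  have "{x} \<in> sets ?P" if "x \<in> space ?P" for x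
    using that singleton_in_sets_PiM[of x "Suc n"] by (simp add: space_PiM PiE_restrict)
  then have "(\<Union>x\<in>F -` A \<inter> space ?P. {x}) \<in> sets ?P"
    using fin by (intro sets.finite_UN) auto
  then show "F -` A \<inter> space ?P \<in> sets ?P"
    by simp
qed simp

lemma prefix_restrict: "F (restrict (\<lambda>i. X i \<omega>) {0..<Suc n}) = F (\<lambda>i. X i \<omega>)"
  by (rule F) auto

lemma measurable_prefix: "(\<lambda>\<omega>. F (\<lambda>i. X i \<omega>)) \<in> borel_measurable M"
proof -
  have "(\<lambda>\<omega>. restrict (\<lambda>i. X i \<omega>) {0..<Suc n}) \<in> M \<rightarrow>\<^sub>M PiM {0..<Suc n} (\<lambda>_. count_space UNIV)"
    by (rule measurable_restrict) simp
  from measurable_compose[OF this measurable_prefix_PiM] show ?thesis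
    by (simp only: prefix_restrict)
qed

lemma integrable_prefix: "integrable M (\<lambda>\<omega>. F (\<lambda>i. X i \<omega>))"
proof -
  have "finite (F ` PiE {0..<Suc n} (\<lambda>_. UNIV))"
    by (intro finite_imageI finite_PiE) auto
  then obtain B where B: "\<And>x. x \<in> PiE {0..<Suc n} (\<lambda>_. UNIV) \<Longrightarrow> \<bar>F x\<bar> \<le> B"
    by (metis finite_imp_bounded bounded_real imageI)
  have "norm (F (\<lambda>i. X i \<omega>)) \<le> B" for \<omega>
    using B[of "restrict (\<lambda>i. X i \<omega>) {0..<Suc n}"] by (simp only: prefix_restrict) auto
  then show ?thesis
    by (intro integrable_const_bound[where B = B] measurable_prefix) auto
qed

text \<open>\<open>X (Suc n)\<close> is independent of the block of coordinates up to
  \<open>n\<close>. This identity serves as the conditional expectation given the past.\<close>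

lemma expectation_X_mult_prefix:
  "expectation (\<lambda>\<omega>. of_bool (X (Suc n) \<omega>) * F (\<lambda>i. X i \<omega>)) = p * expectation (\<lambda>\<omega>. F (\<lambda>i. X i \<omega>))"
proof -
  have "indep_var (PiM {Suc n} (\<lambda>_. count_space UNIV)) (\<lambda>\<omega>. restrict (\<lambda>i. X i \<omega>) {Suc n})
      (PiM {0..<Suc n} (\<lambda>_. count_space UNIV)) (\<lambda>\<omega>. restrict (\<lambda>i. X i \<omega>) {0..<Suc n})"
    by (rule indep_var_restrict[OF indep]) auto
  from indep_var_compose[OF this _ measurable_prefix_PiM, of "\<lambda>x. of_bool (x (Suc n)) :: real" borel]
  have "indep_var borel (\<lambda>\<omega>. of_bool (X (Suc n) \<omega>) :: real) borel (\<lambda>\<omega>. F (\<lambda>i. X i \<omega>))"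
    by (simp add: o_def prefix_restrict del: restrict_apply) measurable
  moreover have "integrable M (\<lambda>\<omega>. of_bool (X (Suc n) \<omega>) :: real)"
    by (rule integrable_const_bound[where B = 1]) auto
  ultimately show ?thesis
    by (simp add: indep_var_lebesgue_integral integrable_prefix expectation_X)
qed

lemma integrable_X_mult_prefix:
  "integrable M (\<lambda>\<omega>. of_bool (X (Suc n) \<omega>) * F (\<lambda>i. X i \<omega>))"
proof (rule Bochner_Integration.integrable_bound[OF integrable_prefix])
  show "(\<lambda>\<omega>. of_bool (X (Suc n) \<omega>) * F (\<lambda>i. X i \<omega>)) \<in> borel_measurable M"
    by (intro borel_measurable_times measurable_prefix) measurable
qed auto

end

section \<open>Geometric tails of the run lengths\<close>

definition S :: "nat \<Rightarrow> 'a \<Rightarrow> real" where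
  "S n \<omega> = real (run_length (\<lambda>i. X i \<omega>) n)"

lemma S_0: "S 0 \<omega> = 0"
  by (simp add: S_def)

lemma S_Suc: "S (Suc n) \<omega> = of_bool (X (Suc n) \<omega>) * (S n \<omega> + 1)"
  by (simp add: S_def)

lemma S_nonneg: "0 \<le> S n \<omega>"
  by (simp add: S_def)

text \<open>A run of length at least \<open>r + 1\<close> at \<open>Suc n\<close> requires
  \<open>X (Suc n)\<close> and a run of length at least \<open>r\<close> at \<open>n\<close>, which
  gives one factor \<open>p\<close>. Equality fails for \<open>s > n\<close>, where runs are cut off
  at index 0.\<close>

lemma expectation_of_bool_le_S: "expectation (\<lambda>\<omega>. of_bool (real s \<le> S n \<omega>)) \<le> p ^ s"
proof (induction n arbitrary: s)
  case 0
  show ?case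
    using p by (cases s) (auto simp: S_0 prob_space)
next
  case (Suc n)
  show ?case
  proof (cases s)
    case (Suc r)
    have "expectation (\<lambda>\<omega>. of_bool (real s \<le> S (Suc n) \<omega>) :: real) =
        expectation (\<lambda>\<omega>. of_bool (X (Suc n) \<omega>) * of_bool (real r \<le> S n \<omega>) :: real)"
      by (intro Bochner_Integration.integral_cong) (auto simp: S_Suc Suc)
    also have "\<dots> = p * expectation (\<lambda>\<omega>. of_bool (real r \<le> S n \<omega>))"
      unfolding S_def by (rule expectation_X_mult_prefix) (drule run_length_cong, simp)
    also have "\<dots> \<le> p * p ^ r"
      using Suc.IH p by (intro mult_left_mono) auto
    finally show ?thesis
      by (simp add: Suc)
  qed (simp add: S_nonneg prob_space)
qed

lemma measurable_S [measurable]: "S n \<in> borel_measurable M"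
  unfolding S_def[abs_def] by (rule measurable_prefix[where n = n]) (drule run_length_cong, simp)

text \<open>The geometric tail at level \<open>(1 + n) powr (1/8)\<close> is a stretched exponential
  in \<open>n\<close>, hence summable, and Borel-Cantelli applies. The constant depends on the
  environment.\<close>

lemma AE_S_bound: "AE \<omega> in M. \<exists>C. \<forall>n. S n \<omega> \<le> C * (1 + real n) powr (1/8)"
proof -
  define A where "A n = {\<omega> \<in> space M. (1 + real n) powr (1/8) < S n \<omega>}" for n
  have [measurable]: "A n \<in> sets M" for n
    unfolding A_def by measurable
  define c where "c = - ln p"
  have c: "0 < c"
    using p by (simp add: c_def)
  have prob_A: "prob (A n) \<le> exp (- c * (1 + real n) powr (1/8))" for n
  proof -
    \<comment> \<open>Run lengths are integers, so exceeding the threshold implies reaching its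
      ceiling.\<close>
    let ?s = "nat \<lceil>(1 + real n) powr (1/8)\<rceil>"
    have "prob (A n) = expectation (indicator (A n))"
      by simp
    also have "\<dots> \<le> expectation (\<lambda>\<omega>. of_bool (real ?s \<le> S n \<omega>))"
    proof (rule integral_mono)
      show "integrable M (\<lambda>\<omega>. of_bool (real ?s \<le> S n \<omega>) :: real)"
        by (rule integrable_const_bound[where B = 1]) auto
      fix \<omega>
      have "?s \<le> run_length (\<lambda>i. X i \<omega>) n" if "\<omega> \<in> A n"
        using that by (simp add: A_def S_def nat_le_iff ceiling_le_iff)
      then have "real ?s \<le> S n \<omega>" if "\<omega> \<in> A n"
        using that unfolding S_def of_nat_le_iff .
      then show "indicator (A n) \<omega> \<le> (of_bool (real ?s \<le> S n \<omega>) :: real)"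
        by (simp add: indicator_def)
    qed (simp add: emeasure_eq_measure)
    also have "\<dots> \<le> p ^ ?s"
      by (rule expectation_of_bool_le_S)
    also have "\<dots> = p powr (real ?s)"
      using p by (intro powr_realpow[symmetric])
    also have "\<dots> \<le> p powr ((1 + real n) powr (1/8))"
      using p by (intro powr_mono') (auto simp: le_of_int_ceiling)
    also have "\<dots> = exp (- c * (1 + real n) powr (1/8))"
      using p by (simp add: powr_def c_def mult.commute)
    finally show ?thesis .
  qed
  have "summable (\<lambda>n. prob (A n))"
  proof (rule summable_comparison_test')
    show "summable (\<lambda>n. exp (- c * (1 + real n) powr (1/8)))"
    proof (rule summable_comparison_test_bigo)
      show "summable (\<lambda>n. norm (real n powr (-2)))"
        by (simp add: summable_real_powr_iff)
      show "(\<lambda>n. exp (- c * (1 + real n) powr (1/8))) \<in> O(\<lambda>n. real n powr (-2))"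
        using c by real_asymp
    qed
  qed (use prob_A in auto)
  then have "AE \<omega> in M. \<forall>\<^sub>F n in sequentially. \<omega> \<in> space M - A n"
    by (intro borel_cantelli_AE1) (auto simp: emeasure_eq_measure)
  then show ?thesis
  proof eventually_elim
    case (elim \<omega>)
    then obtain N where N: "\<And>n. N \<le> n \<Longrightarrow> S n \<omega> \<le> (1 + real n) powr (1/8)"
      by (auto simp: eventually_sequentially A_def not_less)
    have ge_1: "1 \<le> (1 + real n) powr (1/8)" for n
      by (intro ge_one_powr_ge_zero) auto
    have pos: "0 \<le> (\<Sum>i<N. S i \<omega>)"
      by (intro sum_nonneg S_nonneg)
    \<comment> \<open>The sum covers the finitely many indices below \<open>N\<close>, the summand 1
      all the others.\<close>
    have "S n \<omega> \<le> (1 + (\<Sum>i<N. S i \<omega>)) * (1 + real n) powr (1/8)" for n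
    proof (cases "n < N")
      case True
      have "S n \<omega> \<le> (\<Sum>i<N. S i \<omega>)"
        using True by (intro member_le_sum S_nonneg) auto
      also have "\<dots> \<le> (1 + (\<Sum>i<N. S i \<omega>)) * 1"
        by simp
      also have "\<dots> \<le> (1 + (\<Sum>i<N. S i \<omega>)) * (1 + real n) powr (1/8)"
        using pos by (intro mult_left_mono ge_1) auto
      finally show ?thesis .
    next
      case False
      then have "S n \<omega> \<le> 1 * (1 + real n) powr (1/8)"
        using N by simp
      also have "\<dots> \<le> (1 + (\<Sum>i<N. S i \<omega>)) * (1 + real n) powr (1/8)"
        using pos by (intro mult_right_mono) auto
      finally show ?thesis .
    qed
    then show ?case
      by blast
  qed
qed

text \<open>If all \<open>X n\<close> were true then \<open>S n = n\<close>, which contradicts the bound just proved.\<close>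

lemma AE_ex_not_X: "AE \<omega> in M. \<exists>n. \<not> X n \<omega>"
  using AE_S_bound
proof eventually_elim
  case (elim \<omega>)
  then obtain C where C: "\<And>n. S n \<omega> \<le> C * (1 + real n) powr (1/8)"
    by blast
  show ?case
  proof (rule ccontr)
    assume "\<nexists>n. \<not> X n \<omega>"
    then have "S n \<omega> = real n" for n
      by (induction n) (auto simp: S_0 S_Suc)
    with C have "real n \<le> C * (1 + real n) powr (1/8)" for n
      by metis
    moreover have "\<forall>\<^sub>F n in sequentially. C * (1 + real n) powr (1/8) < real n"
      by real_asymp
    ultimately show False
      by (auto simp: eventually_sequentially not_less[symmetric])
  qed
qed

section \<open>The martingale of the environment and the mean run length\<close>

definition T :: "nat \<Rightarrow> 'a \<Rightarrow> real" where
  "T n \<omega> = S n \<omega> + 1"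

lemma T_Suc: "T (Suc n) \<omega> = of_bool (X (Suc n) \<omega>) * T n \<omega> + 1"
  by (simp add: T_def S_Suc)

lemma integrable_T_power: "integrable M (\<lambda>\<omega>. T n \<omega> ^ k)"
  unfolding T_def S_def by (rule integrable_prefix[where n = n]) (drule run_length_cong, simp)

lemma expectation_X_mult_T_power:
  "expectation (\<lambda>\<omega>. of_bool (X (Suc n) \<omega>) * T n \<omega> ^ k) = p * expectation (\<lambda>\<omega>. T n \<omega> ^ k)"
  unfolding T_def S_def by (rule expectation_X_mult_prefix) (drule run_length_cong, simp)

lemma integrable_X_mult_T_power:
  "integrable M (\<lambda>\<omega>. of_bool (X (Suc n) \<omega>) * T n \<omega> ^ k)"
  unfolding T_def S_def by (rule integrable_X_mult_prefix) (drule run_length_cong, simp)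

text \<open>The expectations obey \<open>a \<mapsto> p * a + 1\<close> from the start value 1, which
  lies below the fixed point \<open>1 / (1 - p)\<close>, the mean of a geometric variable.\<close>

lemma expectation_T: "expectation (\<lambda>\<omega>. T n \<omega>) \<le> 1 / (1 - p)"
proof (induction n)
  case 0
  show ?case
    using p by (simp add: T_def S_0 prob_space field_simps)
next
  case (Suc n)
  have "expectation (\<lambda>\<omega>. T (Suc n) \<omega>) = p * expectation (\<lambda>\<omega>. T n \<omega>) + 1"
    using integrable_X_mult_T_power[of n 1] expectation_X_mult_T_power[of n 1]
    by (simp add: T_Suc prob_space)
  also have "\<dots> \<le> p * (1 / (1 - p)) + 1"
    using Suc.IH p by (intro add_right_mono mult_left_mono) auto
  also have "\<dots> = 1 / (1 - p)"
    using p by (simp add: field_simps)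
  finally show ?case .
qed

text \<open>The bound is the second moment of the same geometric variable: the fixed point of
  \<open>a \<mapsto> p * a + 2 * p / (1 - p) + 1\<close>.\<close>

lemma expectation_T_sq: "expectation (\<lambda>\<omega>. (T n \<omega>)\<^sup>2) \<le> (1 + p) / (1 - p)\<^sup>2"
proof (induction n)
  case 0
  have "(1 - p)\<^sup>2 \<le> 1"
    using p by (intro power_le_one) auto
  then show ?case
    using p by (simp add: T_def S_0 prob_space field_simps)
next
  case (Suc n)
  have "(T (Suc n) \<omega>)\<^sup>2 = of_bool (X (Suc n) \<omega>) * (T n \<omega>)\<^sup>2 + 2 * (of_bool (X (Suc n) \<omega>) * T n \<omega>) + 1" for \<omega>
    by (simp add: T_Suc power2_eq_square algebra_simps)
  then have "expectation (\<lambda>\<omega>. (T (Suc n) \<omega>)\<^sup>2) =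
      p * expectation (\<lambda>\<omega>. (T n \<omega>)\<^sup>2) + 2 * (p * expectation (\<lambda>\<omega>. T n \<omega>)) + 1"
    using integrable_X_mult_T_power[of n 1] expectation_X_mult_T_power[of n 1]
      integrable_X_mult_T_power[of n 2] expectation_X_mult_T_power[of n 2]
    by (simp add: prob_space)
  also have "\<dots> \<le> p * ((1 + p) / (1 - p)\<^sup>2) + 2 * (p * (1 / (1 - p))) + 1"
    using Suc.IH expectation_T[of n] p by (intro add_mono mult_left_mono) auto
  also have "\<dots> = (p * (1 + p) + 2 * p * (1 - p) + (1 - p)\<^sup>2) / (1 - p)\<^sup>2"
  proof -
    have "p * ((1 + p) / d\<^sup>2) + 2 * (p * (1 / d)) + 1 = (p * (1 + p) + 2 * p * d + d\<^sup>2) / d\<^sup>2"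
      if "d \<noteq> 0" for d
      using that by (simp add: field_simps power2_eq_square)
    then show ?thesis
      using p by simp
  qed
  also have "p * (1 + p) + 2 * p * (1 - p) + (1 - p)\<^sup>2 = 1 + p"
    by (simp add: power2_eq_square algebra_simps)
  finally show ?case .
qed

text \<open>Closed form of the sum of \<open>(X (i + 1) - p) * T i\<close> over
  \<open>i < n\<close>, obtained from \<open>S (i + 1) = X (i + 1) * T i\<close>. In this form the
  sum of the run lengths can be isolated.\<close>

definition Z :: "nat \<Rightarrow> 'a \<Rightarrow> real" where
  "Z n \<omega> = (1 - p) * (\<Sum>i<n. S i \<omega>) + S n \<omega> - p * real n"

lemma Z_Suc: "Z (Suc n) \<omega> = Z n \<omega> + (of_bool (X (Suc n) \<omega>) - p) * T n \<omega>"
  by (simp add: Z_def S_Suc T_def algebra_simps)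

text \<open>The conjunction lets a single forward step discharge the prefix condition for
  \<open>Z n\<close>.\<close>

lemma sum_run_length_cong:
  assumes "\<And>i. i \<le> n \<Longrightarrow> x i = y i"
  shows "(\<Sum>i<n. real (run_length x i)) = (\<Sum>i<n. real (run_length y i)) \<and>
    run_length x n = run_length y n"
  using assms by (intro conjI sum.cong arg_cong[where f = real] run_length_cong) auto

lemma integrable_Z_sq: "integrable M (\<lambda>\<omega>. (Z n \<omega>)\<^sup>2)"
  unfolding Z_def S_def by (rule integrable_prefix[where n = n]) (drule sum_run_length_cong, simp)

text \<open>Martingale increments are orthogonal, so the second moments add up; each increment
  contributes \<open>p * (1 - p)\<close> times the second moment of \<open>T\<close>.\<close>

lemma expectation_Z_sq: "expectation (\<lambda>\<omega>. (Z n \<omega>)\<^sup>2) \<le> (1 + p) / (1 - p)\<^sup>2 * real n"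
proof (induction n)
  case 0
  show ?case
    by (simp add: Z_def S_0)
next
  case (Suc n)
  have cong: "((1 - p) * (\<Sum>i<n. real (run_length x i)) + real (run_length x n) - p * real n) *
       (real (run_length x n) + 1) =
     ((1 - p) * (\<Sum>i<n. real (run_length y i)) + real (run_length y n) - p * real n) *
       (real (run_length y n) + 1)" if "\<And>i. i \<le> n \<Longrightarrow> x i = y i" for x y
    using sum_run_length_cong[OF that] by simp
  have ZT: "integrable M (\<lambda>\<omega>. Z n \<omega> * T n \<omega>)"
      "integrable M (\<lambda>\<omega>. of_bool (X (Suc n) \<omega>) * (Z n \<omega> * T n \<omega>))"
      "expectation (\<lambda>\<omega>. of_bool (X (Suc n) \<omega>) * (Z n \<omega> * T n \<omega>)) = p * expectation (\<lambda>\<omega>. Z n \<omega> * T n \<omega>)"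
    unfolding Z_def T_def S_def
    by (rule integrable_prefix integrable_X_mult_prefix expectation_X_mult_prefix, rule cong, assumption)+
  \<comment> \<open>As an indicator is its own square, \<open>(X - p)\<^sup>2\<close> equals
    \<open>(1 - 2 * p) * X + p\<^sup>2\<close>. Every term is now a prefix function or such a
    function times \<open>X (Suc n)\<close>.\<close>
  have "(Z (Suc n) \<omega>)\<^sup>2 = (Z n \<omega>)\<^sup>2 +
      2 * (of_bool (X (Suc n) \<omega>) * (Z n \<omega> * T n \<omega>) - p * (Z n \<omega> * T n \<omega>)) +
      ((1 - 2 * p) * (of_bool (X (Suc n) \<omega>) * (T n \<omega>)\<^sup>2) + p\<^sup>2 * (T n \<omega>)\<^sup>2)" for \<omega>
    by (simp add: Z_Suc power2_eq_square algebra_simps)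
  then have "expectation (\<lambda>\<omega>. (Z (Suc n) \<omega>)\<^sup>2) =
      expectation (\<lambda>\<omega>. (Z n \<omega>)\<^sup>2) +
      2 * (p * expectation (\<lambda>\<omega>. Z n \<omega> * T n \<omega>) - p * expectation (\<lambda>\<omega>. Z n \<omega> * T n \<omega>)) +
      ((1 - 2 * p) * (p * expectation (\<lambda>\<omega>. (T n \<omega>)\<^sup>2)) + p\<^sup>2 * expectation (\<lambda>\<omega>. (T n \<omega>)\<^sup>2))"
    using ZT integrable_Z_sq[of n] integrable_T_power[of n 2]
      integrable_X_mult_T_power[of n 2] expectation_X_mult_T_power[of n 2]
    by simp
  also have "\<dots> = expectation (\<lambda>\<omega>. (Z n \<omega>)\<^sup>2) + p * (1 - p) * expectation (\<lambda>\<omega>. (T n \<omega>)\<^sup>2)"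
    by (simp add: power2_eq_square algebra_simps)
  also have "\<dots> \<le> (1 + p) / (1 - p)\<^sup>2 * real n + 1 * ((1 + p) / (1 - p)\<^sup>2)"
    using p by (intro add_mono mult_mono Suc.IH expectation_T_sq mult_le_one) auto
  also have "\<dots> = (1 + p) / (1 - p)\<^sup>2 * real (Suc n)"
    by (simp only: of_nat_Suc distrib_left mult_1 mult_1_right add.commute)
  finally show ?case .
qed

text \<open>Both \<open>Z n / n\<close> and \<open>S n / n\<close> tend to 0, and the definition of
  \<open>Z\<close> is solved for the average.\<close>

lemma AE_S_mean: "AE \<omega> in M. (\<lambda>n. (\<Sum>i<n. S i \<omega>) / real n) \<longlonglongrightarrow> p / (1 - p)"
proof -
  have "AE \<omega> in M. (\<lambda>n. Z n \<omega> / real n) \<longlonglongrightarrow> 0"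
  proof (rule AE_LIMSEQ_div_of_second_moments)
    show "Z n \<in> borel_measurable M" for n
      unfolding Z_def[abs_def] by measurable
    fix n
    let ?K = "(1 + p) / (1 - p)\<^sup>2"
    have "(\<integral>\<^sup>+\<omega>. ennreal ((Z n \<omega>)\<^sup>2) \<partial>M) = ennreal (expectation (\<lambda>\<omega>. (Z n \<omega>)\<^sup>2))"
      by (intro nn_integral_eq_integral integrable_Z_sq) auto
    also have "\<dots> \<le> ennreal (?K * (1 + real n) powr (5/4))"
    proof (intro ennreal_leI order.trans[OF expectation_Z_sq] mult_left_mono)
      have "real n \<le> (1 + real n) powr 1"
        by simp
      also have "\<dots> \<le> (1 + real n) powr (5/4)"
        by (intro powr_mono) auto
      finally show "real n \<le> (1 + real n) powr (5/4)" .
    qed (use p in auto)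
    finally show "(\<integral>\<^sup>+\<omega>. ennreal ((Z n \<omega>)\<^sup>2) \<partial>M) \<le> ennreal (?K * (1 + real n) powr (5/4))" .
  next
    show "AE \<omega> in M. \<exists>C. \<forall>n. \<bar>Z (Suc n) \<omega> - Z n \<omega>\<bar> \<le> C * (1 + real n) powr (1/8)"
      using AE_S_bound
    proof eventually_elim
      case (elim \<omega>)
      then obtain C where C: "\<And>n. S n \<omega> \<le> C * (1 + real n) powr (1/8)"
        by blast
      have "\<bar>Z (Suc n) \<omega> - Z n \<omega>\<bar> \<le> (C + 1) * (1 + real n) powr (1/8)" for n
      proof -
        have "\<bar>Z (Suc n) \<omega> - Z n \<omega>\<bar> = \<bar>of_bool (X (Suc n) \<omega>) - p\<bar> * T n \<omega>"
          using S_nonneg[of n \<omega>] by (simp add: Z_Suc abs_mult T_def)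
        also have "\<dots> \<le> 1 * T n \<omega>"
          using S_nonneg[of n \<omega>] p by (intro mult_right_mono) (auto simp: T_def)
        also have "\<dots> \<le> C * (1 + real n) powr (1/8) + (1 + real n) powr (1/8)"
          using C[of n] ge_one_powr_ge_zero[of "1 + real n" "1/8"] by (simp add: T_def)
        finally show ?thesis
          by (simp add: algebra_simps)
      qed
      then show ?case
        by blast
    qed
  qed
  then show ?thesis
    using AE_S_bound
  proof eventually_elim
    case (elim \<omega>)
    then obtain C where C: "\<And>n. S n \<omega> \<le> C * (1 + real n) powr (1/8)"
      by blast
    have "(\<lambda>n. S n \<omega> / real n) \<longlonglongrightarrow> 0"
    proof (rule tendsto_sandwich[OF _ _ tendsto_const])
      show "(\<lambda>n. C * (1 + real n) powr (1/8) / real n) \<longlonglongrightarrow> 0"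
        by real_asymp
    qed (auto intro!: always_eventually divide_right_mono C S_nonneg divide_nonneg_nonneg)
    with elim(1) have "(\<lambda>n. (Z n \<omega> / real n - S n \<omega> / real n + p) / (1 - p)) \<longlonglongrightarrow> (0 - 0 + p) / (1 - p)"
      using p by (intro tendsto_intros) auto
    then show ?case
      unfolding diff_zero add_0
    proof (rule Lim_transform_eventually)
      show "\<forall>\<^sub>F n in sequentially.
          (Z n \<omega> / real n - S n \<omega> / real n + p) / (1 - p) = (\<Sum>i<n. S i \<omega>) / real n"
        using eventually_gt_at_top[of 0]
        by eventually_elim (use p in \<open>simp add: Z_def field_simps\<close>)
    qed
  qed
qed

end

text \<open>This restricts the environment on the lattice to a half-line. The product formula for
  \<open>J\<close> is the one for its image under \<open>f\<close>, and injectivity identifies the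
  two products.\<close>

lemma (in prob_space) indep_vars_reindex:
  assumes "indep_vars (\<lambda>_. N) X UNIV" and f: "inj f"
  shows "indep_vars (\<lambda>_. N) (\<lambda>i. X (f i)) UNIV"
  unfolding indep_vars_def2 indep_sets_def
proof (intro conjI ballI allI impI)
  let ?F = "\<lambda>i. {X i -` A \<inter> space M |A. A \<in> sets N}"
  have rv: "random_variable N (X i)" for i
    using assms(1) by (simp add: indep_vars_def2)
  then show "random_variable N (X (f i))" for i .
  show "?F (f i) \<subseteq> events" for i
    using measurable_sets[OF rv] by auto
  fix J A
  assume J: "J \<noteq> {}" "finite J" and A: "A \<in> Pi J (\<lambda>i. ?F (f i))"
  define B where "B = A \<circ> inv f"
  have B: "B (f j) = A j" for j
    using f by (simp add: B_def)
  have "\<forall>j\<in>f ` J. B j \<in> ?F j"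
    using A by (auto simp: B Pi_iff)
  moreover have "indep_sets ?F UNIV"
    using assms(1) unfolding indep_vars_def2 by (rule conjunct2)
  ultimately have "prob (\<Inter>j\<in>f ` J. B j) = (\<Prod>j\<in>f ` J. prob (B j))"
    using J by (intro indep_setsD[where I = UNIV and F = ?F]) auto
  also have "\<dots> = (\<Prod>j\<in>J. prob (B (f j)))"
    using inj_on_subset[OF f subset_UNIV] by (rule prod.reindex_cong) auto
  finally show "prob (\<Inter>j\<in>J. A j) = (\<Prod>j\<in>J. prob (A j))"
    by (simp add: B)
qed


section \<open>The speed of the walk\<close>

theorem mainTheorem2:
  fixes p :: real
    and M :: "'w measure"
    and G :: "int \<times> int \<Rightarrow> 'w \<Rightarrow> (int \<times> int) set"
  assumes "0 < p" and "p < 1"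
    and "prob_space M"
    and "prob_space.indep_vars M (\<lambda>_. count_space (Pow unit_steps - {{}})) G UNIV"
    and "\<And>x. measure M {\<omega> \<in> space M. G x \<omega> = {e1, - e1}} = p"
    and "\<And>x. measure M {\<omega> \<in> space M. G x \<omega> = {e1}} = 1 - p"
  shows "measure (annealed_law M G)
           {X \<in> space (annealed_law M G).
              (\<lambda>n. inverse (real n) *\<^sub>R map_prod real_of_int real_of_int (X n))
                \<longlonglongrightarrow> ((1 - p) / (1 + p), 0)} = 1"
proof -
  interpret prob_space M
    by fact
  let ?N = "count_space (Pow unit_steps - {{}}) :: (int \<times> int) set measure"
  let ?E = "{X. (\<lambda>n. inverse (real n) *\<^sub>R map_prod real_of_int real_of_int (X n))
      \<longlonglongrightarrow> ((1 - p) / (1 + p), 0)}"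
  have G [measurable]: "G x \<in> M \<rightarrow>\<^sub>M ?N" for x
    using assms(4) unfolding indep_vars_def2 by blast
  have two_way [measurable]: "{\<omega> \<in> space M. G x \<omega> = {e1, - e1}} \<in> sets M" for x
    using measurable_sets[OF G, of "{{e1, - e1}}" x] by (simp add: vimage_def Int_def unit_steps_def conj_commute)
  have one_way [measurable]: "{\<omega> \<in> space M. G x \<omega> = {e1}} \<in> sets M" for x
    using measurable_sets[OF G, of "{{e1}}" x] by (simp add: vimage_def Int_def unit_steps_def conj_commute)
  have ne: "{e1, - e1} \<noteq> {e1}"
    by (auto simp: e1_def)

  have bernoulli: "bernoulli_sequence M (\<lambda>i \<omega>. G (f i) \<omega> = {e1, - e1}) p" if "inj f" for f :: "nat \<Rightarrow> int \<times> int"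
  proof
    show "indep_vars (\<lambda>_. count_space UNIV) (\<lambda>i \<omega>. G (f i) \<omega> = {e1, - e1}) UNIV"
      by (rule indep_vars_compose2[OF indep_vars_reindex[OF assms(4) that]]) simp
  qed (use assms in auto)

  have "AE \<omega> in M. G x \<omega> = {e1, - e1} \<or> G x \<omega> = {e1}" for x
  proof -
    have "prob ({\<omega> \<in> space M. G x \<omega> = {e1, - e1}} \<union> {\<omega> \<in> space M. G x \<omega> = {e1}}) = 1"
      using ne by (subst finite_measure_Union) (auto simp: assms(5,6))
    from AE_prob_1[OF this] show ?thesis
      by eventually_elim auto
  qed
  then have types: "AE \<omega> in M. \<forall>x. G x \<omega> = {e1, - e1} \<or> G x \<omega> = {e1}"
    by (simp add: AE_all_countable)

  \<comment> \<open>The half-lines to the right supply the estimates beyond a barrier at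
    \<open>(-L, 0)\<close>; the half-line to the left supplies the barrier itself, possibly at the
    origin.\<close>
  have inj_right: "inj (\<lambda>y. (int y - int L, 0 :: int))" for L
    by (simp add: inj_def)
  have inj_left: "inj (\<lambda>m. (- int m, 0 :: int))"
    by (simp add: inj_def)
  have barrier: "AE \<omega> in M. \<exists>L. G (- int L, 0) \<omega> \<noteq> {e1, - e1}"
    by (rule bernoulli_sequence.AE_ex_not_X[OF bernoulli[OF inj_left]])
  \<comment> \<open>The barrier depends on the environment, hence the quantification over all \<open>L\<close> under the AE.\<close>
  have bound: "AE \<omega> in M. \<forall>L. \<exists>C. \<forall>y.
      real (run_length (\<lambda>y. G (int y - int L, 0) \<omega> = {e1, - e1}) y) \<le> C * (1 + real y) powr (1/8)"
    unfolding AE_all_countable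
    using bernoulli_sequence.AE_S_bound[OF bernoulli[OF inj_right]]
    by (simp add: bernoulli_sequence.S_def[OF bernoulli[OF inj_right]])
  have mean: "AE \<omega> in M. \<forall>L. (\<lambda>N. (\<Sum>i<N. real (run_length (\<lambda>y. G (int y - int L, 0) \<omega> = {e1, - e1}) i)) / real N)
      \<longlonglongrightarrow> p / (1 - p)"
    unfolding AE_all_countable
    using bernoulli_sequence.AE_S_mean[OF bernoulli[OF inj_right]]
    by (simp add: bernoulli_sequence.S_def[OF bernoulli[OF inj_right]])

  have sets_E: "?E \<in> sets (PiM UNIV (\<lambda>_. count_space UNIV))"
  proof -
    define d where "d n z = dist (inverse (real n) *\<^sub>R map_prod real_of_int real_of_int z)
      ((1 - p) / (1 + p), 0)" for n z
    have [measurable]: "(\<lambda>X. d n (X n)) \<in> borel_measurable (PiM UNIV (\<lambda>_. count_space UNIV))" for n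
      by (rule measurable_compose[OF measurable_component_singleton]) auto
    \<comment> \<open>Restricting the radii to reciprocals of positive integers leaves only
      countable quantifiers, so the event is measurable.\<close>
    have "X \<in> ?E \<longleftrightarrow> (\<forall>k. \<exists>N. \<forall>n\<ge>N. d n (X n) < inverse (real (Suc k)))" for X
    proof -
      have "X \<in> ?E \<longleftrightarrow> (\<forall>r>0. \<exists>N. \<forall>n\<ge>N. d n (X n) < r)"
        by (simp add: lim_sequentially d_def)
      also have "\<dots> \<longleftrightarrow> (\<forall>k. \<exists>N. \<forall>n\<ge>N. d n (X n) < inverse (real (Suc k)))"
      proof (intro iffI allI impI)
        fix r :: real
        assume *: "\<forall>k. \<exists>N. \<forall>n\<ge>N. d n (X n) < inverse (real (Suc k))" and "0 < r"
        then obtain k where "inverse (real (Suc k)) < r"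
          using reals_Archimedean by blast
        with * show "\<exists>N. \<forall>n\<ge>N. d n (X n) < r"
          by (meson order_less_trans)
      qed simp
      finally show ?thesis .
    qed
    then have "?E = {X \<in> space (PiM UNIV (\<lambda>_. count_space UNIV)).
        \<forall>k. \<exists>N. \<forall>n\<ge>N. d n (X n) < inverse (real (Suc k))}"
      by (simp add: space_PiM set_eq_iff)
    also have "\<dots> \<in> sets (PiM UNIV (\<lambda>_. count_space UNIV))"
      by measurable
    finally show ?thesis .
  qed

  have quenched: "AE \<omega> in M. emeasure (quenched_law (\<lambda>x. G x \<omega>)) ?E = 1"
    using types barrier bound mean
  proof eventually_elim
    case (elim \<omega>)
    \<comment> \<open>Any barrier at or to the left of the origin will do. It becomes index 0, which
      gives \<open>\<not> \<sigma> 0\<close>.\<close>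
    obtain L where L: "G (- int L, 0) \<omega> \<noteq> {e1, - e1}"
      using elim(2) by blast
    define \<sigma> where "\<sigma> y \<longleftrightarrow> G (int y - int L, 0) \<omega> = {e1, - e1}" for y
    obtain C where C: "\<And>y. real (run_length \<sigma> y) \<le> C * (1 + real y) powr (1/8)"
      using elim(3) unfolding \<sigma>_def by blast
    interpret half_line_environment "\<lambda>x. G x \<omega>" L \<sigma> p C
    proof
      show "G (int y - int L, 0) \<omega> = (if \<sigma> y then {e1, - e1} else {e1})" for y
        using elim(1) by (auto simp: \<sigma>_def)
      show "(\<lambda>N. (\<Sum>i<N. real (run_length \<sigma> i)) / real N) \<longlonglongrightarrow> p / (1 - p)"
        using elim(4) unfolding \<sigma>_def by blast
    qed (use L C assms in \<open>auto simp: \<sigma>_def\<close>)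
    interpret Q: prob_space "quenched_law (\<lambda>x. G x \<omega>)"
      unfolding quenched_law_def by (rule prob_space_markov_law)
    show ?case
      using AE_walk_asymp sets_E
      by (intro Q.emeasure_eq_1_AE) (auto simp: quenched_law_def sets_markov_law)
  qed

  have "emeasure (annealed_law M G) ?E = (\<integral>\<^sup>+\<omega>. emeasure (quenched_law (\<lambda>x. G x \<omega>)) ?E \<partial>M)"
    by (rule emeasure_annealed_law[OF assms(3) G sets_E])
  also have "\<dots> = (\<integral>\<^sup>+\<omega>. 1 \<partial>M)"
    using quenched by (rule nn_integral_cong_AE)
  also have "\<dots> = 1"
    by (simp add: emeasure_space_1)
  finally have "measure (annealed_law M G) ?E = 1"
    by (simp add: measure_def)
  moreover have "space (annealed_law M G) = UNIV"
  proof -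
    have "sets (annealed_law M G) = sets (PiM UNIV (\<lambda>_ :: nat. count_space (UNIV :: (int \<times> int) set)))"
      unfolding annealed_law_def
      by (intro sets_bind) (auto simp: quenched_law_def sets_markov_law not_empty)
    from sets_eq_imp_space_eq[OF this] show ?thesis
      by (simp add: space_PiM)
  qed
  ultimately show ?thesis
    by simp
qed

end
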